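(* Let $\nu$ be a probability measure supported on exactly $n$ distinct points $e^{i\lambda_j}$, $1\le j\le n$, of the unit circle, and let $\boldsymbol\tau$ be the Dirac operator corresponding to $\nu$ (defined in the context). Then the left spectral measure $\mu_{\rm left,\boldsymbol\tau}$ of $\boldsymbol\tau$ satisfies $$\mu_{\rm left,\boldsymbol\tau}(\{n\lambda_j+2nk\pi\})=2n\,\nu(\{e^{i\lambda_j}\}),\qquad k\in\mathbb Z,\ 1\le j\le n.$$
   Context: Verblunsky coefficients. Let $\Phi_k$, $0\le k\le n$, be the monic orthogonal polynomials of $\nu$ (Gram–Schmidt applied to $1,z,\dots,z^n$ without normalization, so $\Phi_n(z)=\prod_j(z-e^{i\lambda_j})$), and $\Phi_k^*(z)=z^k\overline{\Phi_k(1/\bar z)}$. The Verblunsky coefficients $\alpha_0,\dots,\alpha_{n-1}$ are defined by $\Phi_{k+1}(z)=z\Phi_k(z)-\bar\alpha_k\Phi_k^*(z)$; they satisfy $|\alpha_k|<1$ for $k\le n-2$ and $|\alpha_{n-1}|=1$. Path parameter. With $\mathcal P\binom{z_1}{z_2}=z_1/z_2$, let $$b_0=0,\qquad b_k=\mathcal P\begin{pmatrix}1&\bar\alpha_0\\\alpha_0&1\end{pmatrix}\cdots\begin{pmatrix}1&\bar\alpha_{k-1}\\\alpha_{k-1}&1\end{pmatrix}\binom01,\quad 1\le k\le n,$$ and $z_k=\mathcal U^{-1}(b_k)$ where $\mathcal U(z)=\frac{z-i}{z+i}$ maps the closed upper half plane (with $\infty$) to the closed unit disk. Then $z_k$ is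 in the open upper half plane for $k\le n-1$ and $z_n\in\mathbb R\cup\{\infty\}$. Dirac operator corresponding to $\nu$. Let $z(t)=z_{\lfloor nt\rfloor}=x(t)+iy(t)$ for $t\in[0,1)$, $$R=\frac{X^tX}{2\det X},\quad X=\begin{pmatrix}1&-x\\0&y\end{pmatrix},\quad J=\begin{pmatrix}0&-1\\1&0\end{pmatrix},$$ $\mathfrak u_0=[1,0]^t$, and $\mathfrak u_1=[-z_n,-1]^t$ if $z_n\in\mathbb R$, $\mathfrak u_1=[1,0]^t$ if $z_n=\infty$. Then $\boldsymbol\tau v=R^{-1}Jv'$ with domain the absolutely continuous $v:[0,1]\to\mathbb R^2$ with $v,R^{-1}Jv'\in L^2_R$, $v(0)^tJ\mathfrak u_0=0$, $v(1)^tJ\mathfrak u_1=0$, where $\|f\|_R^2=\int_0^1f^tRf\,ds$. It is self-adjoint with spectrum $\{n\lambda_j+2\pi nk:1\le j\le n,\ k\in\mathbb Z\}$. Left spectral measure: $\mu_{\rm left,\boldsymbol\tau}=\sum_{\lambda\in\operatorname{spec}\boldsymbol\tau}\frac{f_\lambda(0)^tf_\lambda(0)}{\|f_\lambda\|_R^2}\,\delta_\lambda$, with $f_\lambda$ an eigenfunction for $\lambda$. *)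

theory Defs
  imports
    "HOL-Probability.Probability"
    "HOL-Computational_Algebra.Polynomial"
begin

section \<open>Orthogonal polynomials and Verblunsky coefficients\<close>

definition poly_inner :: "complex measure \<Rightarrow> complex poly \<Rightarrow> complex poly \<Rightarrow> complex" where
  "poly_inner \<nu> p q = (LINT z|\<nu>. cnj (poly p z) * poly q z)"

declare sum.cong [fundef_cong]

text \<open>
  For a measure with exactly \<open>n\<close> atoms, \<open>poly_inner \<nu> (monic_OP \<nu> j) (monic_OP \<nu> j)\<close> is nonzero for
  \<open>j < n\<close>, so no division by zero occurs for \<open>k \<le> n\<close>; only these \<open>k\<close> are used.
\<close>

fun monic_OP :: "complex measure \<Rightarrow> nat \<Rightarrow> complex poly" where
  "monic_OP \<nu> k = monom 1 k -
     (\<Sum>j<k. smult (poly_inner \<nu> (monic_OP \<nu> j) (monom 1 k)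
                    / poly_inner \<nu> (monic_OP \<nu> j) (monic_OP \<nu> j)) (monic_OP \<nu> j))"

declare monic_OP.simps [simp del]

text \<open>
  Since \<open>monic_OP \<nu> k\<close> is monic of degree \<open>k\<close>, reversing its coefficients and conjugating them gives
  the polynomial \<open>z ^ k * cnj (poly (monic_OP \<nu> k) (1 / cnj z))\<close>, extended to \<open>z = 0\<close>.
\<close>

definition reversed_OP :: "complex measure \<Rightarrow> nat \<Rightarrow> complex poly" where
  "reversed_OP \<nu> k = map_poly cnj (reflect_poly (monic_OP \<nu> k))"

definition verblunsky :: "complex measure \<Rightarrow> nat \<Rightarrow> complex" where
  "verblunsky \<nu> k = (THE \<alpha>. monic_OP \<nu> (Suc k) =
     pCons 0 (monic_OP \<nu> k) - smult (cnj \<alpha>) (reversed_OP \<nu> k))"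


section \<open>The path parameter\<close>

fun verblunsky_prod :: "complex measure \<Rightarrow> nat \<Rightarrow> complex^2^2" where
  "verblunsky_prod \<nu> 0 = mat 1"
| "verblunsky_prod \<nu> (Suc k) = verblunsky_prod \<nu> k **
     vector [vector [1, cnj (verblunsky \<nu> k)], vector [verblunsky \<nu> k, 1]]"

definition proj_ratio :: "complex^2 \<Rightarrow> complex" where
  "proj_ratio w = w $ 1 / w $ 2"

definition path_b :: "complex measure \<Rightarrow> nat \<Rightarrow> complex" where
  "path_b \<nu> k = proj_ratio (verblunsky_prod \<nu> k *v vector [0, 1])"

text \<open>The point at infinity of the closed upper half plane is represented by \<open>None\<close>.\<close>

definition closed_upper_half_plane :: "complex option set" where
  "closed_upper_half_plane = insert None (Some ` {z. 0 \<le> Im z})"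

definition cayley :: "complex option \<Rightarrow> complex" where
  "cayley w = (case w of None \<Rightarrow> 1 | Some z \<Rightarrow> (z - \<i>) / (z + \<i>))"

definition path_z :: "complex measure \<Rightarrow> nat \<Rightarrow> complex option" where
  "path_z \<nu> k = the_inv_into closed_upper_half_plane cayley (path_b \<nu> k)"


section \<open>Dirac operators on the unit interval\<close>

definition abs_continuous_on :: "real \<Rightarrow> real \<Rightarrow> (real \<Rightarrow> 'a::real_normed_vector) \<Rightarrow> bool" where
  "abs_continuous_on a b f \<longleftrightarrow> (\<forall>\<epsilon>>0. \<exists>\<delta>>0. \<forall>d T. d division_of T \<longrightarrow> T \<subseteq> {a..b} \<longrightarrow>
     (\<Sum>K\<in>d. measure lborel K) < \<delta> \<longrightarrow>
     (\<Sum>K\<in>d. norm (f (interval_upperbound K) - f (interval_lowerbound K))) < \<epsilon>)"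

definition Jmat :: "real^2^2" where
  "Jmat = vector [vector [0, -1], vector [1, 0]]"

text \<open>
  \<open>L2_R R\<close> consists of functions on \<open>{0..<1}\<close>; equality of its elements is equality almost everywhere
  and is written out wherever it is needed.
\<close>

definition L2_R :: "(real \<Rightarrow> real^2^2) \<Rightarrow> (real \<Rightarrow> real^2) set" where
  "L2_R R = {f. f \<in> borel_measurable (lebesgue_on {0..<1}) \<and>
                integrable (lebesgue_on {0..<1}) (\<lambda>s. f s \<bullet> (R s *v f s))}"

definition norm_R :: "(real \<Rightarrow> real^2^2) \<Rightarrow> (real \<Rightarrow> real^2) \<Rightarrow> real" where
  "norm_R R f = sqrt (LINT s|lebesgue_on {0..<1}. f s \<bullet> (R s *v f s))"

definition dirac_op :: "(real \<Rightarrow> real^2^2) \<Rightarrow> (real \<Rightarrow> real^2) \<Rightarrow> real \<Rightarrow> real^2" where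
  "dirac_op R v t = matrix_inv (R t) *v (Jmat *v vector_derivative v (at t))"

text \<open>
  Absolute continuity already implies differentiability almost everywhere. The second conjunct is
  therefore redundant; it makes explicit that \<open>vector_derivative\<close> is a genuine derivative almost
  everywhere.
\<close>

definition dirac_dom :: "(real \<Rightarrow> real^2^2) \<Rightarrow> real^2 \<Rightarrow> real^2 \<Rightarrow> (real \<Rightarrow> real^2) set" where
  "dirac_dom R u0 u1 = {v. abs_continuous_on 0 1 v \<and>
     (AE t in lebesgue_on {0..<1}. v differentiable (at t)) \<and>
     v \<in> L2_R R \<and> dirac_op R v \<in> L2_R R \<and>
     v 0 \<bullet> (Jmat *v u0) = 0 \<and> v 1 \<bullet> (Jmat *v u1) = 0}"

text \<open>
  The complement of the resolvent set: \<open>\<mu>\<close> is in the resolvent set iff \<open>dirac_op R - \<mu>\<close> maps the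
  domain onto \<open>L2_R R\<close> and has a bounded inverse (the lower bound entails injectivity). Only real
  \<open>\<mu>\<close> are considered because the operators in question are self-adjoint.
\<close>

definition dirac_spectrum :: "(real \<Rightarrow> real^2^2) \<Rightarrow> real^2 \<Rightarrow> real^2 \<Rightarrow> real set" where
  "dirac_spectrum R u0 u1 = {\<mu>. \<not> (
     (\<exists>C. \<forall>v\<in>dirac_dom R u0 u1. norm_R R v \<le> C * norm_R R (\<lambda>t. dirac_op R v t - \<mu> *\<^sub>R v t)) \<and>
     (\<forall>g\<in>L2_R R. \<exists>v\<in>dirac_dom R u0 u1.
        AE t in lebesgue_on {0..<1}. dirac_op R v t - \<mu> *\<^sub>R v t = g t))}"

definition is_eigenfunction ::
    "(real \<Rightarrow> real^2^2) \<Rightarrow> real^2 \<Rightarrow> real^2 \<Rightarrow> real \<Rightarrow> (real \<Rightarrow> real^2) \<Rightarrow> bool" where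
  "is_eigenfunction R u0 u1 \<mu> f \<longleftrightarrow> f \<in> dirac_dom R u0 u1 \<and>
     \<not> (AE t in lebesgue_on {0..<1}. f t = 0) \<and>
     (AE t in lebesgue_on {0..<1}. dirac_op R f t = \<mu> *\<^sub>R f t)"

text \<open>
  Eigenspaces are one-dimensional because of the boundary condition at \<open>0\<close>, so the weight does not
  depend on the eigenfunction chosen by \<open>SOME\<close>.
\<close>

definition left_weight :: "(real \<Rightarrow> real^2^2) \<Rightarrow> real^2 \<Rightarrow> real^2 \<Rightarrow> real \<Rightarrow> real" where
  "left_weight R u0 u1 \<mu> =
     (let f = (SOME f. is_eigenfunction R u0 u1 \<mu> f) in (f 0 \<bullet> f 0) / (norm_R R f)\<^sup>2)"

text \<open>The sum of the point masses \<open>left_weight R u0 u1 \<mu>\<close> at \<open>\<mu>\<close> in the spectrum, as a Borel measure.\<close>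

definition left_spectral_measure :: "(real \<Rightarrow> real^2^2) \<Rightarrow> real^2 \<Rightarrow> real^2 \<Rightarrow> real measure" where
  "left_spectral_measure R u0 u1 =
     distr (density (count_space (dirac_spectrum R u0 u1)) (\<lambda>\<mu>. ennreal (left_weight R u0 u1 \<mu>)))
       borel (\<lambda>\<mu>. \<mu>)"


section \<open>The Dirac operator of a finitely supported measure\<close>

definition Xmat :: "complex \<Rightarrow> real^2^2" where
  "Xmat z = vector [vector [1, - Re z], vector [0, Im z]]"

definition Rmat :: "complex \<Rightarrow> real^2^2" where
  "Rmat z = (1 / (2 * det (Xmat z))) *\<^sub>R (transpose (Xmat z) ** Xmat z)"

text \<open>For \<open>t\<close> in \<open>{0..<1}\<close> the index is at most \<open>n - 1\<close>, where \<open>path_z\<close> is finite.\<close>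

definition measure_R :: "complex measure \<Rightarrow> nat \<Rightarrow> real \<Rightarrow> real^2^2" where
  "measure_R \<nu> n t = Rmat (the (path_z \<nu> (nat \<lfloor>real n * t\<rfloor>)))"

definition bdry_u0 :: "real^2" where
  "bdry_u0 = vector [1, 0]"

definition bdry_u1 :: "complex measure \<Rightarrow> nat \<Rightarrow> real^2" where
  "bdry_u1 \<nu> n = (case path_z \<nu> n of None \<Rightarrow> vector [1, 0] | Some z \<Rightarrow> vector [- Re z, -1])"

definition mu_left :: "complex measure \<Rightarrow> nat \<Rightarrow> real measure" where
  "mu_left \<nu> n = left_spectral_measure (measure_R \<nu> n) bdry_u0 (bdry_u1 \<nu> n)"

end

theory Submission
  imports Defs
begin

text \<open>
  Encode \<open>v\<close> as \<open>q = v\<^sub>1 + \<i> v\<^sub>2\<close> and write the product of the first \<open>k\<close> Verblunsky matrices as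
  \<open>(A\<^sup>* B; B\<^sup>* A)\<close>. On the \<open>k\<close>-th piece the coordinate \<open>P = A q\<^sup>* - B q\<close> of a solution
  of the Dirac equation rotates with speed \<open>\<mu>/2\<close>, and passing to the next piece replaces \<open>P\<close> by
  \<open>P - \<alpha>\<^sup>* P\<^sup>*\<close>. This is the Szego recursion, so that \<open>|P| = |\<Phi>\<^sub>k(z)|\<close> with
  \<open>z = exp(\<i> \<mu>/n)\<close>, and \<open>v\<^sup>t R v = |\<Phi>\<^sub>k(z)|\<^sup>2 / (2 N\<^sub>k)\<close> with \<open>N\<^sub>k\<close> the squared norm of
  \<open>\<Phi>\<^sub>k\<close>. If \<open>z\<close> is an atom, \<open>\<Phi>\<^sub>n(z) = 0\<close> is the boundary condition at \<open>1\<close>, and the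
  Christoffel identity \<open>\<Sum>\<^sub>k |\<Phi>\<^sub>k(z)|\<^sup>2 / N\<^sub>k = 1 / \<nu>{z}\<close> evaluates the norm of the
  eigenfunction. Since the eigenfunction in the weight is arbitrary, it also has to be shown that
  an absolutely continuous solution is determined by its initial value.
\<close>

section \<open>Absolutely continuous functions\<close>

lemma abs_continuous_onE:
  assumes "abs_continuous_on a b f" and "0 < e"
  obtains r where "0 < r" "\<And>D T. D division_of T \<Longrightarrow> T \<subseteq> {a..b} \<Longrightarrow>
      (\<Sum>K\<in>D. measure lborel K) < r \<Longrightarrow>
      (\<Sum>K\<in>D. norm (f (interval_upperbound K) - f (interval_lowerbound K))) < e"
  using assms unfolding abs_continuous_on_def by blast

lemma abs_continuous_onI:
  assumes "\<And>e. 0 < e \<Longrightarrow> \<exists>r>0. \<forall>D T. D division_of T \<longrightarrow> T \<subseteq> {a..b} \<longrightarrow>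
      (\<Sum>K\<in>D. measure lborel K) < r \<longrightarrow>
      (\<Sum>K\<in>D. norm (f (interval_upperbound K) - f (interval_lowerbound K))) < e"
  shows "abs_continuous_on a b f"
  using assms unfolding abs_continuous_on_def by blast

lemma abs_continuous_on_subset:
  assumes "abs_continuous_on a b f" and "a \<le> c" and "d \<le> b"
  shows "abs_continuous_on c d f"
proof (rule abs_continuous_onI)
  fix e :: real assume "0 < e"
  with assms(1) obtain r where r: "r > 0" "\<And>D T. D division_of T \<Longrightarrow> T \<subseteq> {a..b} \<Longrightarrow>
      (\<Sum>K\<in>D. measure lborel K) < r \<Longrightarrow>
      (\<Sum>K\<in>D. norm (f (interval_upperbound K) - f (interval_lowerbound K))) < e"
    by (rule abs_continuous_onE) blast
  have "{c..d} \<subseteq> {a..b}" using assms by auto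
  with r show "\<exists>r>0. \<forall>D T. D division_of T \<longrightarrow> T \<subseteq> {c..d} \<longrightarrow> (\<Sum>K\<in>D. measure lborel K) < r \<longrightarrow>
      (\<Sum>K\<in>D. norm (f (interval_upperbound K) - f (interval_lowerbound K))) < e"
    by (meson order_trans)
qed

lemma lipschitz_on_imp_abs_continuous_on:
  assumes L: "L-lipschitz_on {a..b} f"
  shows "abs_continuous_on a b f"
proof (rule abs_continuous_onI)
  fix e :: real assume e: "0 < e"
  have L0: "L \<ge> 0" using L by (rule lipschitz_on_nonneg)
  show "\<exists>r>0. \<forall>D T. D division_of T \<longrightarrow> T \<subseteq> {a..b} \<longrightarrow> (\<Sum>K\<in>D. measure lborel K) < r \<longrightarrow>
      (\<Sum>K\<in>D. norm (f (interval_upperbound K) - f (interval_lowerbound K))) < e"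
  \<comment> \<open>The shift by 1 keeps the quotient positive when \<open>L = 0\<close>.\<close>
  proof (intro exI[of _ "e / (L + 1)"] conjI allI impI)
    fix D T assume D: "D division_of T" and T: "T \<subseteq> {a..b}"
      and small: "(\<Sum>K\<in>D. measure lborel K) < e / (L + 1)"
    have "norm (f (interval_upperbound K) - f (interval_lowerbound K)) \<le> L * measure lborel K"
      if KD: "K \<in> D" for K
    proof -
      obtain u v where K: "K = {u..v}" "u \<le> v"
        using division_ofD(3,4)[OF D KD] by auto
      moreover have "{u..v} \<subseteq> {a..b}"
        using division_ofD(2)[OF D KD] K T by (metis order_trans)
      ultimately show ?thesis
        using lipschitz_on_normD[OF L, of v u] by simp
    qed
    then have "(\<Sum>K\<in>D. norm (f (interval_upperbound K) - f (interval_lowerbound K)))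
        \<le> L * (\<Sum>K\<in>D. measure lborel K)"
      unfolding sum_distrib_left by (rule sum_mono)
    also have "\<dots> \<le> (L + 1) * (\<Sum>K\<in>D. measure lborel K)"
      by (intro mult_right_mono sum_nonneg) auto
    also have "\<dots> < e"
      using small L0 by (simp add: field_simps)
    finally show "(\<Sum>K\<in>D. norm (f (interval_upperbound K) - f (interval_lowerbound K))) < e" .
  qed (use e L0 in auto)
qed

lemma abs_continuous_on_diff:
  assumes f: "abs_continuous_on a b f" and g: "abs_continuous_on a b g"
  shows "abs_continuous_on a b (\<lambda>x. f x - g x)"
proof (rule abs_continuous_onI)
  fix e :: real assume "0 < e"
  then have e: "0 < e / 2" by simp
  obtain r where r: "r > 0" "\<And>D T. D division_of T \<Longrightarrow> T \<subseteq> {a..b} \<Longrightarrow>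
      (\<Sum>K\<in>D. measure lborel K) < r \<Longrightarrow>
      (\<Sum>K\<in>D. norm (f (interval_upperbound K) - f (interval_lowerbound K))) < e / 2"
    using f e by (rule abs_continuous_onE) blast
  obtain s where s: "s > 0" "\<And>D T. D division_of T \<Longrightarrow> T \<subseteq> {a..b} \<Longrightarrow>
      (\<Sum>K\<in>D. measure lborel K) < s \<Longrightarrow>
      (\<Sum>K\<in>D. norm (g (interval_upperbound K) - g (interval_lowerbound K))) < e / 2"
    using g e by (rule abs_continuous_onE) blast
  show "\<exists>r>0. \<forall>D T. D division_of T \<longrightarrow> T \<subseteq> {a..b} \<longrightarrow> (\<Sum>K\<in>D. measure lborel K) < r \<longrightarrow>
      (\<Sum>K\<in>D. norm (f (interval_upperbound K) - g (interval_upperbound K) -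
         (f (interval_lowerbound K) - g (interval_lowerbound K)))) < e"
  proof (intro exI[of _ "min r s"] conjI allI impI)
    fix D T assume D: "D division_of T" "T \<subseteq> {a..b}" "(\<Sum>K\<in>D. measure lborel K) < min r s"
    have "(\<Sum>K\<in>D. norm (f (interval_upperbound K) - g (interval_upperbound K) -
         (f (interval_lowerbound K) - g (interval_lowerbound K))))
       \<le> (\<Sum>K\<in>D. norm (f (interval_upperbound K) - f (interval_lowerbound K))
            + norm (g (interval_upperbound K) - g (interval_lowerbound K)))"
    proof (rule sum_mono)
      fix K
      show "norm (f (interval_upperbound K) - g (interval_upperbound K) -
         (f (interval_lowerbound K) - g (interval_lowerbound K)))
        \<le> norm (f (interval_upperbound K) - f (interval_lowerbound K))
            + norm (g (interval_upperbound K) - g (interval_lowerbound K))"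
        using norm_triangle_ineq4[of "f (interval_upperbound K) - f (interval_lowerbound K)"
            "g (interval_upperbound K) - g (interval_lowerbound K)"] by (simp add: algebra_simps)
    qed
    also have "\<dots> < e"
      using r(2)[OF D(1,2)] s(2)[OF D(1,2)] D(3) by (simp add: sum.distrib)
    finally show "(\<Sum>K\<in>D. norm (f (interval_upperbound K) - g (interval_upperbound K) -
         (f (interval_lowerbound K) - g (interval_lowerbound K)))) < e" .
  qed (use r(1) s(1) in auto)
qed

lemma abs_continuous_on_imp_continuous_on:
  assumes "abs_continuous_on a b f"
  shows "continuous_on {a..b} f"
  unfolding continuous_on_iff
proof (intro ballI allI impI)
  fix x e :: real assume x: "x \<in> {a..b}" and e: "0 < e"
  obtain r where r: "r > 0" "\<And>D T. D division_of T \<Longrightarrow> T \<subseteq> {a..b} \<Longrightarrow>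
      (\<Sum>K\<in>D. measure lborel K) < r \<Longrightarrow>
      (\<Sum>K\<in>D. norm (f (interval_upperbound K) - f (interval_lowerbound K))) < e"
    using assms e by (rule abs_continuous_onE) blast
  have small: "norm (f v - f u) < e" if "u \<le> v" "{u..v} \<subseteq> {a..b}" "v - u < r" for u v
  proof -
    have "{{u..v}} division_of {u..v}"
      using division_of_self[of u v] that(1) by simp
    from r(2)[OF this that(2)] show ?thesis using that(1,3) by simp
  qed
  have "dist (f y) (f x) < e" if y: "y \<in> {a..b}" "dist y x < r" for y
  proof (cases "x \<le> y")
    case True
    then have "norm (f y - f x) < e"
      using x y by (intro small) (auto simp: dist_real_def)
    then show ?thesis by (simp add: dist_norm)
  next
    case False
    then have "norm (f x - f y) < e"
      using x y by (intro small) (auto simp: dist_real_def)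
    then show ?thesis by (simp add: dist_norm norm_minus_commute)
  qed
  with r(1) show "\<exists>d>0. \<forall>y\<in>{a..b}. dist y x < d \<longrightarrow> dist (f y) (f x) < e" by blast
qed

text \<open>Outer regularity. The open set later serves as the gauge at tags in the null set, which
  forces the intervals there to have small total length.\<close>

lemma negligible_open_superset:
  fixes N :: "'a::euclidean_space set"
  assumes "negligible N" and "e > 0"
  obtains U where "open U" "N \<subseteq> U" "U \<in> lmeasurable" "measure lebesgue U < e"
proof -
  have N: "N \<in> sets lebesgue" "emeasure lebesgue N = 0"
    using assms(1) by (auto simp: negligible_iff_null_sets)
  obtain U where U: "open U" "N \<subseteq> U" "emeasure lebesgue (U - N) < ennreal e"
    using sets_lebesgue_outer_open[OF N(1) assms(2)] by metis
  have "emeasure lebesgue U = emeasure lebesgue (U - N)"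
    using U(1,2) N by (subst emeasure_Diff_null_set) auto
  with U have less: "emeasure lebesgue U < ennreal e" by simp
  then have "U \<in> lmeasurable"
    using U(1) by (intro fmeasurableI) (auto intro: order.strict_trans)
  moreover from this less have "measure lebesgue U < e"
    using assms(2) by (auto simp: emeasure_eq_measure2 ennreal_less_iff)
  ultimately show thesis using U that by blast
qed

text \<open>Cousin's lemma: in a division fine for a suitable gauge, the intervals tagged outside the null
  set \<open>N\<close> are controlled by the derivatives, and those tagged in \<open>N\<close> by absolute continuity.\<close>

lemma abs_continuous_on_increment_le:
  fixes F :: "real \<Rightarrow> 'a::real_normed_vector" and \<phi> :: "real \<Rightarrow> real"
  assumes ab: "a \<le> b" and AC: "abs_continuous_on a b F" and N: "negligible N"
    and F: "\<And>x. x \<in> {a..b} - N \<Longrightarrow> (F has_vector_derivative F' x) (at x)"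
    and \<phi>: "\<And>x. x \<in> {a..b} - N \<Longrightarrow> (\<phi> has_vector_derivative \<phi>' x) (at x)"
    and le: "\<And>x. x \<in> {a..b} - N \<Longrightarrow> norm (F' x) \<le> \<phi>' x"
    and mono: "mono_on {a..b} \<phi>"
  shows "norm (F b - F a) \<le> \<phi> b - \<phi> a"
proof (rule field_le_epsilon)
  fix e0 :: real assume e0: "0 < e0"
  \<comment> \<open>One \<open>e\<close> pays for the intervals tagged in \<open>N\<close>; the
    others cost \<open>2 * e\<close> per unit length, once for the derivative of \<open>F\<close>
    and once for that of \<open>\<phi>\<close>.\<close>
  define e where "e = e0 / (1 + 2 * (b - a))"
  have pos: "0 < 1 + 2 * (b - a)" using ab by simp
  have e: "0 < e" using e0 pos by (simp add: e_def)
  have "e * (1 + 2 * (b - a)) = e0" using pos by (simp add: e_def)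
  then have e_eq: "e + 2 * e * (b - a) = e0" by (simp add: algebra_simps)
  obtain \<delta> where \<delta>: "\<delta> > 0" "\<And>D T. D division_of T \<Longrightarrow> T \<subseteq> {a..b} \<Longrightarrow>
      (\<Sum>K\<in>D. measure lborel K) < \<delta> \<Longrightarrow>
      (\<Sum>K\<in>D. norm (F (interval_upperbound K) - F (interval_lowerbound K))) < e"
    using AC e by (rule abs_continuous_onE) blast
  obtain U where U: "open U" "N \<subseteq> U" "U \<in> lmeasurable" "measure lebesgue U < \<delta>"
    using negligible_open_superset[OF N \<delta>(1)] .
  have "\<exists>r>0. \<forall>y. \<bar>y - x\<bar> < r \<longrightarrow> norm (F y - F x) \<le> (\<phi>' x + e) * \<bar>y - x\<bar> \<and>
      \<bar>\<phi> y - \<phi> x - \<phi>' x * (y - x)\<bar> \<le> e * \<bar>y - x\<bar>" if x: "x \<in> {a..b} - N" for x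
  proof -
    obtain r1 where r1: "r1 > 0"
      "\<And>y. \<bar>y - x\<bar> < r1 \<Longrightarrow> norm (F y - F x - (y - x) *\<^sub>R F' x) \<le> e * \<bar>y - x\<bar>"
      using F[OF x] e unfolding has_vector_derivative_def has_derivative_at_alt real_norm_def by blast
    obtain r2 where r2: "r2 > 0"
      "\<And>y. \<bar>y - x\<bar> < r2 \<Longrightarrow> \<bar>\<phi> y - \<phi> x - (y - x) *\<^sub>R \<phi>' x\<bar> \<le> e * \<bar>y - x\<bar>"
      using \<phi>[OF x] e unfolding has_vector_derivative_def has_derivative_at_alt real_norm_def by blast
    have "norm (F y - F x) \<le> (\<phi>' x + e) * \<bar>y - x\<bar>" if "\<bar>y - x\<bar> < r1" for y
    proof -
      have "norm (F y - F x) \<le> norm (F y - F x - (y - x) *\<^sub>R F' x) + norm ((y - x) *\<^sub>R F' x)"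
        using norm_triangle_ineq[of "F y - F x - (y - x) *\<^sub>R F' x" "(y - x) *\<^sub>R F' x"] by simp
      also have "\<dots> \<le> e * \<bar>y - x\<bar> + \<bar>y - x\<bar> * \<phi>' x"
        using r1(2)[OF that] le[OF x] by (auto intro!: add_mono mult_left_mono)
      finally show ?thesis by (simp add: algebra_simps)
    qed
    then show ?thesis using r1 r2
      by (intro exI[of _ "min r1 r2"]) (auto simp: mult.commute)
  qed
  then have "\<forall>x\<in>{a..b} - N. \<exists>r. r > 0 \<and> (\<forall>y. \<bar>y - x\<bar> < r \<longrightarrow> norm (F y - F x) \<le> (\<phi>' x + e) * \<bar>y - x\<bar> \<and>
      \<bar>\<phi> y - \<phi> x - \<phi>' x * (y - x)\<bar> \<le> e * \<bar>y - x\<bar>)"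
    by blast
  then obtain r where "\<forall>x\<in>{a..b} - N. r x > 0 \<and> (\<forall>y. \<bar>y - x\<bar> < r x \<longrightarrow>
      norm (F y - F x) \<le> (\<phi>' x + e) * \<bar>y - x\<bar> \<and>
      \<bar>\<phi> y - \<phi> x - \<phi>' x * (y - x)\<bar> \<le> e * \<bar>y - x\<bar>)"
    by (rule bchoice[THEN exE])
  then have r: "\<And>x. x \<in> {a..b} - N \<Longrightarrow> r x > 0"
    "\<And>x y. x \<in> {a..b} - N \<Longrightarrow> \<bar>y - x\<bar> < r x \<Longrightarrow> norm (F y - F x) \<le> (\<phi>' x + e) * \<bar>y - x\<bar>"
    "\<And>x y. x \<in> {a..b} - N \<Longrightarrow> \<bar>y - x\<bar> < r x \<Longrightarrow> \<bar>\<phi> y - \<phi> x - \<phi>' x * (y - x)\<bar> \<le> e * \<bar>y - x\<bar>"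
    by blast+
  define \<gamma> where "\<gamma> x = (if x \<in> N then U else if x \<in> {a..b} then ball x (r x) else UNIV)" for x
  have "gauge \<gamma>"
    using U r(1) by (auto simp: gauge_def \<gamma>_def)
  then obtain p where p: "p tagged_division_of {a..b}" and fine: "\<gamma> fine p"
    by (rule fine_division_exists_real)
  define p1 where "p1 = {(x, K) \<in> p. x \<in> N}"
  have p1: "p1 \<subseteq> p" and finp: "finite p" using p by (auto simp: p1_def)
  have K: "\<exists>u v. K = {u..v} \<and> u \<le> v \<and> x \<in> {u..v} \<and> {u..v} \<subseteq> {a..b}" if "(x, K) \<in> p" for x K
    using tagged_division_ofD(2-4)[OF p that] by fastforce
  have tp: "p1 tagged_partial_division_of {a..b}"
    using tagged_partial_division_subset[OF _ p1] p by (auto simp: tagged_division_of_def)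
  have div: "snd ` p1 division_of \<Union>(snd ` p1)"
    by (rule partial_division_of_tagged_division[OF tp])
  have "(\<Sum>K\<in>snd ` p1. measure lborel K) = (\<Sum>K\<in>snd ` p1. measure lebesgue K)"
    using K p1 by (intro sum.cong) fastforce+
  also have "\<dots> = measure lebesgue (\<Union>(snd ` p1))"
    by (rule content_division[OF div])
  also have "\<dots> \<le> measure lebesgue U"
  proof (rule measure_mono_fmeasurable)
    show "\<Union>(snd ` p1) \<subseteq> U"
      using fineD[OF fine] by (force simp: \<gamma>_def p1_def)
  qed (use U lmeasurable_division[OF div] in auto)
  finally have small: "(\<Sum>K\<in>snd ` p1. measure lborel K) < \<delta>"
    using U(4) by linarith
  have "\<Union>(snd ` p1) \<subseteq> {a..b}"
    using tagged_partial_division_ofD(3)[OF tp] by (intro Union_least) (metis imageE prod.collapse)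
  then have "(\<Sum>K\<in>snd ` p1. norm (F (interval_upperbound K) - F (interval_lowerbound K))) < e"
    using \<delta>(2)[OF div] small by blast
  moreover have "(\<Sum>(x, K)\<in>p1. norm (F (Sup K) - F (Inf K)))
      = (\<Sum>K\<in>snd ` p1. norm (F (interval_upperbound K) - F (interval_lowerbound K)))"
  proof -
    \<comment> \<open>Passing from tagged pairs to intervals requires a summand that vanishes on
      every interval with empty interior. The empty set is treated apart because
      \<open>Sup {}\<close> and \<open>Inf {}\<close> are uncontrolled.\<close>
    let ?d = "\<lambda>K. if K = {} then 0 else norm (F (Sup K) - F (Inf K))"
    have "(\<Sum>(x, K)\<in>p1. norm (F (Sup K) - F (Inf K))) = (\<Sum>(x, K)\<in>p1. ?d K)"
      using K p1 by (intro sum.cong) fastforce+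
    also have "\<dots> = (\<Sum>K\<in>snd ` p1. ?d K)"
      by (rule sum.over_tagged_division_lemma[OF tagged_partial_division_of_Union_self[OF tp]]) auto
    also have "\<dots> = (\<Sum>K\<in>snd ` p1. norm (F (interval_upperbound K) - F (interval_lowerbound K)))"
      using K p1 by (intro sum.cong) fastforce+
    finally show ?thesis .
  qed
  ultimately have bad: "(\<Sum>(x, K)\<in>p1. norm (F (Sup K) - F (Inf K))) < e"
    by simp
  let ?g = "\<lambda>(x, K). \<phi> (Sup K) - \<phi> (Inf K) + 2 * e * (Sup K - Inf K)"
  have "(\<Sum>(x, K)\<in>p - p1. norm (F (Sup K) - F (Inf K))) \<le> sum ?g (p - p1)"
  proof (rule sum_mono, clarify)
    fix x K assume xK: "(x, K) \<in> p" "(x, K) \<notin> p1"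
    obtain u v where uv: "K = {u..v}" "u \<le> x" "x \<le> v" "{u..v} \<subseteq> {a..b}"
      using K[OF xK(1)] by auto
    have x: "x \<in> {a..b} - N" using xK uv by (auto simp: p1_def)
    have "{u..v} \<subseteq> ball x (r x)"
      using fineD[OF fine xK(1)] x uv by (simp add: \<gamma>_def)
    moreover have "u \<in> {u..v}" "v \<in> {u..v}" using uv by auto
    ultimately have near: "\<bar>u - x\<bar> < r x" "\<bar>v - x\<bar> < r x"
      unfolding mem_ball dist_real_def by (metis abs_minus_commute dist_real_def mem_ball subsetD)+
    have "norm (F v - F u) \<le> norm (F v - F x) + norm (F u - F x)"
      using norm_triangle_ineq4[of "F v - F x" "F u - F x"] by simp
    also have "\<dots> \<le> (\<phi>' x + e) * (v - x) + (\<phi>' x + e) * (x - u)"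
      using r(2)[OF x near(1)] r(2)[OF x near(2)] uv by simp
    also have "\<dots> \<le> \<phi> v - \<phi> u + 2 * e * (v - u)"
      using r(3)[OF x near(1)] r(3)[OF x near(2)] uv by (simp add: abs_le_iff algebra_simps)
    finally show "norm (F (Sup K) - F (Inf K)) \<le> \<phi> (Sup K) - \<phi> (Inf K) + 2 * e * (Sup K - Inf K)"
      using uv by simp
  qed
  \<comment> \<open>\<open>\<phi>\<close> is monotone, so adding the terms tagged in
    \<open>N\<close> only enlarges the sum, which then telescopes over all of
    \<open>p\<close>.\<close>
  also have "sum ?g (p - p1) \<le> sum ?g p"
  proof (rule sum_mono2[OF finp])
    fix i assume "i \<in> p - (p - p1)"
    then obtain x k where i: "i = (x, k)" "(x, k) \<in> p" by (cases i) auto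
    then obtain u v where "k = {u..v}" "u \<le> v" "{u..v} \<subseteq> {a..b}" using K by blast
    then show "0 \<le> ?g i" using i e mono_onD[OF mono, of u v] by simp
  qed auto
  also have "sum ?g p = (\<phi> b + 2 * e * b) - (\<phi> a + 2 * e * a)"
    using additive_tagged_division_1[OF ab p, of "\<lambda>x. \<phi> x + 2 * e * x"]
    by (simp add: algebra_simps case_prod_unfold)
  finally have good: "(\<Sum>(x, K)\<in>p - p1. norm (F (Sup K) - F (Inf K))) \<le> \<phi> b - \<phi> a + 2 * e * (b - a)"
    by (simp add: algebra_simps)
  have "norm (F b - F a) = norm (\<Sum>(x, K)\<in>p. F (Sup K) - F (Inf K))"
    using additive_tagged_division_1[OF ab p, of F] by simp
  also have "\<dots> \<le> (\<Sum>(x, K)\<in>p. norm (F (Sup K) - F (Inf K)))"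
    by (rule order_trans[OF norm_sum]) (simp add: case_prod_unfold)
  also have "\<dots> = (\<Sum>(x, K)\<in>p - p1. norm (F (Sup K) - F (Inf K))) + (\<Sum>(x, K)\<in>p1. norm (F (Sup K) - F (Inf K)))"
    by (rule sum.subset_diff[OF p1 finp])
  also have "\<dots> \<le> \<phi> b - \<phi> a + e0"
    using good bad e_eq by simp
  finally show "norm (F b - F a) \<le> \<phi> b - \<phi> a + e0" .
qed

text \<open>Gronwall with an exponentially weighted norm: \<open>h\<close> attains its maximum at
  some \<open>s\<close>, and the increment bound up to \<open>s\<close> gives back at most half of
  that maximum, so the maximum is 0.\<close>

lemma abs_continuous_on_gronwall_zero:
  fixes F :: "real \<Rightarrow> 'a::real_normed_vector"
  assumes AC: "abs_continuous_on a b F" and N: "negligible N"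
    and F: "\<And>x. x \<in> {a..b} - N \<Longrightarrow> (F has_vector_derivative F' x) (at x)"
    and le: "\<And>x. x \<in> {a..b} - N \<Longrightarrow> norm (F' x) \<le> C * norm (F x)"
    and zero: "F a = 0" and t: "t \<in> {a..b}"
  shows "F t = 0"
proof -
  define c where "c = \<bar>C\<bar> + 1"
  have c: "c > 0" "C \<le> c" by (auto simp: c_def)
  define h where "h x = exp (- (2 * c * x)) * norm (F x)" for x
  have "continuous_on {a..b} h"
    unfolding h_def by (intro continuous_intros abs_continuous_on_imp_continuous_on AC)
  then obtain s where s: "s \<in> {a..b}" "\<And>x. x \<in> {a..b} \<Longrightarrow> h x \<le> h s"
    using continuous_attains_sup[of "{a..b}" h] t by fastforce
  \<comment> \<open>An antiderivative of \<open>c * (h s * exp (2 * c * x))\<close>, which dominates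
    \<open>norm (F' x)\<close>; the exponent \<open>2 * c\<close> instead of \<open>c\<close>
    produces the factor 1/2.\<close>
  define \<phi> where "\<phi> x = h s / 2 * exp (2 * c * x)" for x
  have h0: "0 \<le> h s" by (simp add: h_def)
  have bound: "norm (F x) \<le> h s * exp (2 * c * x)" if "x \<in> {a..b}" for x
    using s(2)[OF that] by (simp add: h_def exp_minus field_simps)
  have "norm (F s - F a) \<le> \<phi> s - \<phi> a"
  proof (rule abs_continuous_on_increment_le[where F' = F' and \<phi>' = "\<lambda>x. c * (h s * exp (2 * c * x))"])
    show "abs_continuous_on a s F"
      by (rule abs_continuous_on_subset[OF AC]) (use s in auto)
    show "norm (F' x) \<le> c * (h s * exp (2 * c * x))" if "x \<in> {a..s} - N" for x
    proof -
      have "x \<in> {a..b} - N" using that s by auto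
      then have "norm (F' x) \<le> C * norm (F x)" by (rule le)
      also have "\<dots> \<le> c * norm (F x)" using c by (intro mult_right_mono) auto
      also have "\<dots> \<le> c * (h s * exp (2 * c * x))"
        using bound[of x] that s c by (intro mult_left_mono) auto
      finally show ?thesis .
    qed
    show "(\<phi> has_vector_derivative c * (h s * exp (2 * c * x))) (at x)" for x
      unfolding \<phi>_def has_real_derivative_iff_has_vector_derivative[symmetric]
      by (auto intro!: derivative_eq_intros)
    show "mono_on {a..s} \<phi>"
      unfolding \<phi>_def mono_on_def using h0 c by (auto intro!: mult_left_mono)
  qed (use s N F in auto)
  also have "\<dots> \<le> \<phi> s" using h0 by (simp add: \<phi>_def)
  finally have "h s \<le> h s / 2"
    using zero by (simp add: h_def \<phi>_def exp_minus field_simps)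
  then have "h t \<le> 0" using s(2)[OF t] by simp
  then show ?thesis by (simp add: h_def mult_le_0_iff not_le)
qed

section \<open>Orthogonal polynomials for a finitely supported measure\<close>

lemma poly_inner_smult_left: "poly_inner \<nu> (smult c p) q = cnj c * poly_inner \<nu> p q"
  by (simp add: poly_inner_def mult.assoc)

lemma poly_inner_smult_right: "poly_inner \<nu> p (smult c q) = c * poly_inner \<nu> p q"
  by (simp add: poly_inner_def mult.left_commute)

lemma poly_inner_commute: "poly_inner \<nu> q p = cnj (poly_inner \<nu> p q)"
  unfolding poly_inner_def by (subst Bochner_Integration.integral_cnj[symmetric])
    (simp add: mult.commute del: Bochner_Integration.integral_cnj)

text \<open>A condition on coefficients rather than on \<open>degree\<close>, so that the zero
  polynomial qualifies for every \<open>k\<close>, even \<open>k = 0\<close>, where inductions on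
  the bound start.\<close>

abbreviation deg_lt :: "nat \<Rightarrow> 'a::zero poly \<Rightarrow> bool" where
  "deg_lt k p \<equiv> \<forall>i\<ge>k. coeff p i = 0"

lemma deg_lt_degree: "deg_lt k p \<Longrightarrow> p \<noteq> 0 \<Longrightarrow> degree p < k"
  by (metis leading_coeff_0_iff not_le)

text \<open>The support enters as a set without enumeration, and the \<open>n\<close> of the theorem
  becomes \<open>card Z\<close>.\<close>

locale circle_atoms = prob_space \<nu> for \<nu> :: "complex measure" +
  fixes Z :: "complex set"
  assumes sets_eq [measurable_cong]: "sets \<nu> = sets borel"
    and finite_Z: "finite Z"
    and norm_Z: "z \<in> Z \<Longrightarrow> norm z = 1"
    and AE_Z: "AE z in \<nu>. z \<in> Z"
    and atom_pos: "z \<in> Z \<Longrightarrow> 0 < measure \<nu> {z}"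
begin

abbreviation "\<Phi> \<equiv> monic_OP \<nu>"
abbreviation "\<Psi> \<equiv> reversed_OP \<nu>"
abbreviation "\<alpha> \<equiv> verblunsky \<nu>"
abbreviation "I \<equiv> poly_inner \<nu>"
abbreviation "m z \<equiv> measure \<nu> {z}"
abbreviation "n \<equiv> card Z"

lemma integral_eq_sum:
  fixes f :: "complex \<Rightarrow> complex"
  assumes [measurable]: "f \<in> borel_measurable borel"
  shows "(LINT z|\<nu>. f z) = (\<Sum>z\<in>Z. m z * f z)"
proof -
  have "(LINT z|\<nu>. f z) = (LINT z|\<nu>. (\<Sum>w\<in>Z. indicator {w} z *\<^sub>R f w))"
  proof (rule integral_cong_AE)
    show "AE z in \<nu>. f z = (\<Sum>w\<in>Z. indicator {w} z *\<^sub>R f w)"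
      using AE_Z
    proof eventually_elim
      case (elim z)
      have "(\<Sum>w\<in>Z. indicator {w} z *\<^sub>R f w) = (\<Sum>w\<in>Z. if w = z then f w else 0)"
        by (intro sum.cong) (auto simp: indicator_def)
      then show ?case using elim finite_Z by simp
    qed
  qed measurable
  also have "\<dots> = (\<Sum>w\<in>Z. (LINT z|\<nu>. indicator {w} z *\<^sub>R f w))"
    by (rule Bochner_Integration.integral_sum) (auto simp: sets_eq emeasure_eq_measure)
  also have "\<dots> = (\<Sum>w\<in>Z. m w * f w)"
    by (intro sum.cong) (auto simp: sets_eq emeasure_eq_measure scaleR_conv_of_real Int_def
        sets_eq_imp_space_eq[OF sets_eq])
  finally show ?thesis .
qed

lemma inner_eq: "I p q = (\<Sum>z\<in>Z. m z * (cnj (poly p z) * poly q z))"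
  unfolding poly_inner_def
  by (subst integral_eq_sum) (auto intro!: borel_measurable_continuous_onI continuous_intros)

lemma inner_eqI:
  assumes "\<And>z. z \<in> Z \<Longrightarrow> cnj (poly p z) * poly q z = cnj (poly p' z) * poly q' z"
  shows "I p q = I p' q'"
  unfolding inner_eq using assms by (intro sum.cong) auto

lemma inner_add_left: "I (p + p') q = I p q + I p' q"
  and inner_add_right: "I p (q + q') = I p q + I p q'"
  and inner_diff_left: "I (p - p') q = I p q - I p' q"
  and inner_diff_right: "I p (q - q') = I p q - I p q'"
  by (simp_all add: inner_eq algebra_simps sum.distrib sum_subtractf)

lemma inner_zero_right [simp]: "I p 0 = 0" by (simp add: inner_eq)

lemma inner_sum_right: "I p (\<Sum>i\<in>S. f i) = (\<Sum>i\<in>S. I p (f i))"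
  by (induction S rule: infinite_finite_induct) (auto simp: inner_add_right)

lemma inner_self: "I p p = of_real (\<Sum>z\<in>Z. m z * (norm (poly p z))\<^sup>2)"
  unfolding inner_eq of_real_sum of_real_mult complex_norm_square
  by (simp add: mult.commute)

lemma inner_self_eq_0: "I p p = 0 \<Longrightarrow> z \<in> Z \<Longrightarrow> poly p z = 0"
  unfolding inner_self of_real_eq_0_iff
  by (subst (asm) sum_nonneg_eq_0_iff) (use finite_Z atom_pos in \<open>force simp: less_le\<close>)+

text \<open>Root counting: \<open>Z\<close> has \<open>n\<close> points. Below degree
  \<open>n\<close> this makes the inner product definite, although on all polynomials it is
  degenerate.\<close>

lemma deg_lt_eq_0:
  assumes "deg_lt n p" "\<And>z. z \<in> Z \<Longrightarrow> poly p z = 0" shows "p = 0"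
proof (rule ccontr)
  assume "p \<noteq> 0"
  then have "n \<le> card {z. poly p z = 0}"
    using assms(2) by (intro card_mono poly_roots_finite) auto
  also have "\<dots> \<le> degree p" by (rule card_poly_roots_bound[OF \<open>p \<noteq> 0\<close>])
  finally show False using deg_lt_degree[OF assms(1) \<open>p \<noteq> 0\<close>] by simp
qed

lemma inner_self_eq_0_imp: "deg_lt n p \<Longrightarrow> I p p = 0 \<Longrightarrow> p = 0"
  using deg_lt_eq_0 inner_self_eq_0 by blast

section \<open>Gram-Schmidt: degrees and orthogonality\<close>

lemma coeff_OP: "coeff (\<Phi> k) k = 1 \<and> deg_lt (Suc k) (\<Phi> k)"
proof (induction k rule: less_induct)
  case (less k)
  have z: "coeff (\<Phi> j) i = 0" if "j < k" "k \<le> i" for i j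
    using less[OF that(1)] that by auto
  show ?case
    by (subst (1 2) monic_OP.simps) (auto simp: coeff_sum z intro!: sum.neutral)
qed

lemma deg_lt_OP: "k < j \<Longrightarrow> deg_lt j (\<Phi> k)"
  using coeff_OP[of k] by auto

lemma degree_OP: "degree (\<Phi> k) = k"
  using coeff_OP[of k] by (intro antisym degree_le le_degree) auto

lemma OP_nonzero: "\<Phi> k \<noteq> 0"
  using coeff_OP[of k] by auto

lemma inner_OP_self_nonzero: "k < n \<Longrightarrow> I (\<Phi> k) (\<Phi> k) \<noteq> 0"
  using inner_self_eq_0_imp OP_nonzero deg_lt_OP by blast

text \<open>By strong induction the earlier polynomials are mutually orthogonal, so only the summand
  \<open>i = j\<close> survives and cancels the first term. The case \<open>k = n\<close> is
  included because the denominators involve only indices below \<open>k\<close>.\<close>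

lemma OP_orthogonal: "k \<le> n \<Longrightarrow> j < k \<Longrightarrow> I (\<Phi> j) (\<Phi> k) = 0"
proof (induction k arbitrary: j rule: less_induct)
  case (less k)
  have orth: "I (\<Phi> j) (\<Phi> i) = 0" if "i < k" "i \<noteq> j" for i
  proof (cases "i < j")
    case True
    then have "I (\<Phi> i) (\<Phi> j) = 0" using less by simp
    then show ?thesis by (subst poly_inner_commute) simp
  next
    case False
    then show ?thesis using less that by simp
  qed
  let ?c = "\<lambda>i. I (\<Phi> i) (monom 1 k) / I (\<Phi> i) (\<Phi> i)"
  have "I (\<Phi> j) (\<Phi> k) = I (\<Phi> j) (monom 1 k) - (\<Sum>i<k. ?c i * I (\<Phi> j) (\<Phi> i))"
    by (subst (2) monic_OP.simps) (simp add: inner_diff_right inner_sum_right poly_inner_smult_right)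
  also have "(\<Sum>i<k. ?c i * I (\<Phi> j) (\<Phi> i)) = (\<Sum>i<k. if i = j then ?c j * I (\<Phi> j) (\<Phi> j) else 0)"
    by (intro sum.cong) (auto simp: orth)
  also have "\<dots> = I (\<Phi> j) (monom 1 k)"
    using less inner_OP_self_nonzero[of j] by simp
  finally show ?case by simp
qed

text \<open>Subtracting the multiple of \<open>\<Phi> k\<close> that removes the top coefficient
  lowers the degree bound; the first \<open>k\<close> orthogonal polynomials thus span everything of
  degree below \<open>k\<close>.\<close>

lemma inner_deg_lt_eq_0:
  assumes "deg_lt k p" "\<And>j. j < k \<Longrightarrow> I (\<Phi> j) q = 0"
  shows "I p q = 0"
  using assms
proof (induction k arbitrary: p)
  case 0
  then have "p = 0" by (simp add: poly_eq_iff)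
  then show ?case by (simp add: inner_eq)
next
  case (Suc k)
  define p' where "p' = p - smult (coeff p k) (\<Phi> k)"
  have "deg_lt k p'"
  proof (intro allI impI)
    fix i assume "k \<le> i"
    then show "coeff p' i = 0"
      using Suc.prems(1) coeff_OP[of k] by (cases "i = k") (auto simp: p'_def)
  qed
  then have "I p' q = 0" using Suc by simp
  then show ?case using Suc.prems(2)[of k]
    by (simp add: p'_def inner_diff_left poly_inner_smult_left)
qed

lemma inner_deg_lt_OP: "deg_lt k p \<Longrightarrow> k \<le> n \<Longrightarrow> I p (\<Phi> k) = 0"
  using OP_orthogonal by (blast intro: inner_deg_lt_eq_0)

text \<open>The monic node polynomial \<open>g\<close> vanishes on \<open>Z\<close>, so
  \<open>\<Phi> n - g\<close> has degree below \<open>n\<close> and is orthogonal both to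
  \<open>\<Phi> n\<close> and to \<open>g\<close>, hence to itself; definiteness gives
  \<open>\<Phi> n = g\<close>.\<close>

lemma OP_card_root:
  assumes "z \<in> Z" shows "poly (\<Phi> n) z = 0"
proof -
  define g where "g = (\<Prod>z\<in>Z. [:- z, 1:])"
  have g0: "poly g y = 0" if "y \<in> Z" for y
    using that finite_Z by (auto simp: g_def poly_prod)
  have deg: "degree g = n"
    unfolding g_def by (subst degree_prod_eq_sum_degree) auto
  have lead: "lead_coeff g = 1"
    unfolding g_def by (subst lead_coeff_prod) auto
  have lt: "deg_lt n (\<Phi> n - g)"
  proof (intro allI impI)
    fix i assume "n \<le> i"
    then show "coeff (\<Phi> n - g) i = 0"
      using deg coeff_OP[of n] lead by (cases "i = n") (auto simp: coeff_eq_0)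
  qed
  have "I (\<Phi> n - g) (\<Phi> n - g) = I (\<Phi> n - g) (\<Phi> n) - I (\<Phi> n - g) g"
    by (rule inner_diff_right)
  also have "\<dots> = 0"
    using inner_deg_lt_OP[OF lt] by (simp add: inner_eq g0)
  finally have "\<Phi> n - g = 0" by (rule inner_self_eq_0_imp[OF lt])
  then show ?thesis using g0[OF assms] by simp
qed

section \<open>Reversed polynomials and the Szego recursion\<close>

lemma poly_reversed_OP:
  assumes "norm z = 1" shows "poly (\<Psi> k) z = z ^ k * cnj (poly (\<Phi> k) z)"
proof -
  have z: "z \<noteq> 0" "inverse (cnj z) = z"
    using assms by (auto simp: inverse_eq_divide complex_div_cnj[of 1] )
  have "poly (\<Psi> k) z = cnj (poly (reflect_poly (\<Phi> k)) (cnj z))"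
    by (simp add: reversed_OP_def)
  also have "\<dots> = z ^ k * cnj (poly (\<Phi> k) z)"
    using z by (subst poly_reflect_poly_nz) (auto simp: degree_OP)
  finally show ?thesis .
qed

lemma coeff_0_reversed_OP: "coeff (\<Psi> k) 0 = 1"
  using coeff_OP[of k] by (simp add: reversed_OP_def coeff_map_poly degree_OP)

lemma deg_lt_reversed_OP: "deg_lt (Suc k) (\<Psi> k)"
proof -
  have "degree (reflect_poly (\<Phi> k)) \<le> k"
    using degree_reflect_poly_le[of "\<Phi> k"] by (simp add: degree_OP)
  then show ?thesis by (auto simp: reversed_OP_def coeff_map_poly coeff_eq_0)
qed

text \<open>On the circle \<open>cnj (z * p) * \<Psi> k\<close> equals
  \<open>cnj (\<Phi> k) * q\<close>, where \<open>q\<close> is \<open>z ^ k * cnj (z * p)\<close>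
  rewritten as a polynomial by means of \<open>cnj z = 1 / z\<close>. The reversal keeps the degree
  below \<open>k\<close>, and \<open>\<Phi> k\<close> is orthogonal to such polynomials.\<close>

lemma reversed_OP_orthogonal:
  assumes E: "deg_lt k p" and k: "k \<le> n"
  shows "I (pCons 0 p) (\<Psi> k) = 0"
proof -
  define q where "q = (\<Sum>i<k. monom (cnj (coeff p i)) (k - 1 - i))"
  have q: "deg_lt k q" by (auto simp: q_def coeff_sum intro!: sum.neutral)
  have "I (pCons 0 p) (\<Psi> k) = I (\<Phi> k) q"
  proof (rule inner_eqI)
    fix z assume "z \<in> Z"
    then have z: "norm z = 1" by (rule norm_Z)
    then have zz: "cnj z * z = 1" using complex_norm_square[of z] by (simp add: mult.commute)
    have "degree p < k \<or> p = 0" using deg_lt_degree[OF E] by blast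
    then have "poly p z = (\<Sum>i<k. coeff p i * z ^ i)"
    proof
      assume "degree p < k"
      then show ?thesis
        by (subst poly_altdef, intro sum.mono_neutral_left) (auto simp: coeff_eq_0)
    qed simp
    then have "cnj (z * poly p z) * z ^ k = (\<Sum>i<k. cnj (coeff p i) * (cnj z * cnj z ^ i * z ^ k))"
      by (simp add: sum_distrib_left sum_distrib_right algebra_simps)
    also have "\<dots> = poly q z"
      unfolding q_def poly_sum poly_monom
    proof (intro sum.cong refl arg_cong2[of _ _ _ _ "(*)"])
      fix i assume "i \<in> {..<k}"
      then have "k = Suc i + (k - 1 - i)" by simp
      then have "cnj z * cnj z ^ i * z ^ k = cnj z ^ Suc i * z ^ (Suc i + (k - 1 - i))" by simp
      also have "\<dots> = (cnj z * z) ^ Suc i * z ^ (k - 1 - i)"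
        by (simp only: power_add power_mult_distrib mult.assoc)
      finally show "cnj z * cnj z ^ i * z ^ k = z ^ (k - 1 - i)" using zz by simp
    qed
    finally show "cnj (poly (pCons 0 p) z) * poly (\<Psi> k) z = cnj (poly (\<Phi> k) z) * poly q z"
      using poly_reversed_OP[OF z, of k] by (simp add: algebra_simps)
  qed
  also have "\<dots> = cnj (I q (\<Phi> k))" by (rule poly_inner_commute)
  also have "\<dots> = 0" using inner_deg_lt_OP[OF q k] by simp
  finally show ?thesis .
qed

text \<open>Multiplication by \<open>z\<close> is isometric because \<open>norm z = 1\<close> on
  \<open>Z\<close>.\<close>

lemma inner_pCons: "I (pCons 0 p) (pCons 0 q) = I p q"
proof (rule inner_eqI)
  fix z assume "z \<in> Z"
  then have "cnj z * z = 1" using complex_norm_square[of z] norm_Z by (simp add: mult.commute)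
  then show "cnj (poly (pCons 0 p) z) * poly (pCons 0 q) z = cnj (poly p z) * poly q z"
    by (simp add: algebra_simps)
qed

text \<open>The defect \<open>D\<close> has no constant term and its top terms cancel, so it is
  \<open>z\<close> times some \<open>E\<close> of degree below \<open>k\<close>. It is orthogonal to
  each of the three polynomials from which it is built, hence to itself.\<close>

lemma szego_recursion_ex:
  assumes k: "k < n"
  shows "\<exists>c. \<Phi> (Suc k) = pCons 0 (\<Phi> k) - smult c (\<Psi> k)"
proof -
  \<comment> \<open>\<open>\<Psi> k\<close> has constant coefficient 1, so this is the only
    \<open>c\<close> that cancels the constant term of \<open>D\<close>.\<close>
  define c where "c = - coeff (\<Phi> (Suc k)) 0"
  define D where "D = pCons 0 (\<Phi> k) - \<Phi> (Suc k) - smult c (\<Psi> k)"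
  have "coeff D 0 = 0" by (simp add: D_def c_def coeff_0_reversed_OP)
  then obtain E where E: "D = pCons 0 E" by (metis pCons_cases coeff_pCons_0)
  have D_lt: "deg_lt (Suc k) D"
  proof (intro allI impI)
    fix i assume i: "Suc k \<le> i"
    then obtain i' where i': "i = Suc i'" "k \<le> i'" by (cases i) auto
    show "coeff D i = 0"
      using i' coeff_OP[of k] coeff_OP[of "Suc k"] deg_lt_reversed_OP[of k]
      by (cases "i' = k") (auto simp: D_def)
  qed
  have E_lt: "deg_lt k E"
  proof (intro allI impI)
    fix i assume "k \<le> i"
    then show "coeff E i = 0" using D_lt[rule_format, of "Suc i"] E by simp
  qed
  have "I D D = I (pCons 0 E) (pCons 0 (\<Phi> k)) - I D (\<Phi> (Suc k)) - c * I (pCons 0 E) (\<Psi> k)"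
    by (simp add: D_def[symmetric] E[symmetric] inner_diff_right[symmetric] poly_inner_smult_right[symmetric])
  also have "\<dots> = 0"
    using inner_deg_lt_OP[OF D_lt] inner_deg_lt_OP[OF E_lt] reversed_OP_orthogonal[OF E_lt] k
    by (simp add: inner_pCons)
  finally have "D = 0"
    using D_lt k by (intro inner_self_eq_0_imp) auto
  then show ?thesis by (auto simp: D_def algebra_simps intro!: exI[of _ c])
qed

text \<open>Comparing constant coefficients shows that the factor is unique, so the
  \<open>THE\<close> in \<open>verblunsky\<close> denotes it.\<close>

lemma szego_recursion:
  assumes k: "k < n"
  shows "\<Phi> (Suc k) = pCons 0 (\<Phi> k) - smult (cnj (\<alpha> k)) (\<Psi> k)"
proof -
  obtain c where c: "\<Phi> (Suc k) = pCons 0 (\<Phi> k) - smult c (\<Psi> k)"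
    using szego_recursion_ex[OF k] by blast
  show ?thesis unfolding verblunsky_def
  proof (rule theI[of _ "cnj c"])
    show "\<Phi> (Suc k) = pCons 0 (\<Phi> k) - smult (cnj (cnj c)) (\<Psi> k)" using c by simp
    fix a assume "\<Phi> (Suc k) = pCons 0 (\<Phi> k) - smult (cnj a) (\<Psi> k)"
    then have "coeff (smult (cnj a) (\<Psi> k)) 0 = coeff (smult c (\<Psi> k)) 0" using c by simp
    then show "a = cnj c" by (simp add: coeff_0_reversed_OP) (metis complex_cnj_cnj)
  qed
qed

section \<open>Squared norms and the Christoffel identity\<close>

definition N :: "nat \<Rightarrow> real" where "N k = (\<Sum>z\<in>Z. m z * (norm (poly (\<Phi> k) z))\<^sup>2)"

lemma inner_OP_self: "I (\<Phi> k) (\<Phi> k) = of_real (N k)"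
  by (simp add: inner_self N_def)

lemma N_pos: "k < n \<Longrightarrow> 0 < N k"
  using inner_OP_self_nonzero[of k] unfolding inner_OP_self less_le of_real_eq_0_iff
  by (auto simp: N_def intro!: sum_nonneg)

lemma N_card: "N n = 0"
  by (simp add: N_def OP_card_root)

lemma N_0: "N 0 = 1"
proof -
  have "\<Phi> 0 = 1" by (subst monic_OP.simps) simp
  then have "of_real (N 0) = (LINT z|\<nu>. (1::complex))"
    by (simp add: inner_OP_self[symmetric] poly_inner_def)
  also have "\<dots> = 1" using prob_space by simp
  finally show ?thesis by (simp only: of_real_eq_1_iff)
qed

text \<open>Pythagoras for the recursion solved for \<open>pCons 0 (\<Phi> k)\<close>:
  \<open>\<Psi> k\<close> has degree at most \<open>k\<close>, so it is orthogonal to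
  \<open>\<Phi> (Suc k)\<close>, and on the circle it has the same modulus as
  \<open>\<Phi> k\<close>.\<close>

lemma N_Suc:
  assumes k: "k < n"
  shows "N (Suc k) = N k * (1 - (norm (\<alpha> k))\<^sup>2)"
proof -
  have eq: "pCons 0 (\<Phi> k) = \<Phi> (Suc k) + smult (cnj (\<alpha> k)) (\<Psi> k)"
    using szego_recursion[OF k] by simp
  have 1: "I (\<Psi> k) (\<Phi> (Suc k)) = 0"
    using inner_deg_lt_OP[OF deg_lt_reversed_OP] k by simp
  then have 2: "I (\<Phi> (Suc k)) (\<Psi> k) = 0" by (subst poly_inner_commute) simp
  have 3: "I (\<Psi> k) (\<Psi> k) = I (\<Phi> k) (\<Phi> k)"
    using norm_Z by (simp add: inner_self poly_reversed_OP norm_mult norm_power)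
  have "of_real (N k) = I (pCons 0 (\<Phi> k)) (pCons 0 (\<Phi> k))"
    by (simp add: inner_pCons inner_OP_self)
  also have "\<dots> = of_real (N (Suc k)) + \<alpha> k * cnj (\<alpha> k) * of_real (N k)"
    unfolding eq inner_add_left inner_add_right poly_inner_smult_left poly_inner_smult_right 1 2 3
      inner_OP_self by simp
  also have "\<dots> = of_real (N (Suc k) + (norm (\<alpha> k))\<^sup>2 * N k)"
    by (simp only: complex_norm_square[symmetric] of_real_mult of_real_add)
  finally have "N k = N (Suc k) + (norm (\<alpha> k))\<^sup>2 * N k" by (simp only: of_real_eq_iff)
  then show ?thesis by (simp add: algebra_simps)
qed

text \<open>Expand the Lagrange polynomial of the node \<open>z\<close> in the orthogonal basis and evaluate it at \<open>z\<close>.\<close>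

lemma christoffel:
  assumes z: "z \<in> Z"
  shows "(\<Sum>k<n. (norm (poly (\<Phi> k) z))\<^sup>2 / N k) = 1 / m z"
proof -
  define g where "g = (\<Prod>y\<in>Z - {z}. [:- y, 1:])"
  have gz: "poly g z \<noteq> 0" and gy: "\<And>y. y \<in> Z \<Longrightarrow> y \<noteq> z \<Longrightarrow> poly g y = 0"
    using finite_Z by (auto simp: g_def poly_prod)
  have "degree g = n - 1"
    unfolding g_def using z finite_Z by (subst degree_prod_eq_sum_degree) auto
  moreover have "0 < n" using z finite_Z by (auto simp: card_gt_0_iff)
  ultimately have g_lt: "deg_lt n g" by (auto simp: coeff_eq_0)
  \<comment> \<open>The remainder of the expansion has degree below \<open>n\<close> and is
    orthogonal to every \<open>\<Phi> j\<close> with \<open>j < n\<close>, hence is zero.\<close>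
  define D where "D = g - (\<Sum>k<n. smult (I (\<Phi> k) g / I (\<Phi> k) (\<Phi> k)) (\<Phi> k))"
  have D_lt: "deg_lt n D"
    using g_lt coeff_OP by (auto simp: D_def coeff_sum intro!: sum.neutral)
  have "I (\<Phi> j) D = 0" if j: "j < n" for j
  proof -
    have orth: "I (\<Phi> j) (\<Phi> i) = 0" if "i < n" "i \<noteq> j" for i
    proof (cases "i < j")
      case True
      then have "I (\<Phi> i) (\<Phi> j) = 0" using j by (simp add: OP_orthogonal)
      then show ?thesis by (subst poly_inner_commute) simp
    qed (use that in \<open>simp add: OP_orthogonal\<close>)
    have "I (\<Phi> j) D = I (\<Phi> j) g - (\<Sum>k<n. I (\<Phi> k) g / I (\<Phi> k) (\<Phi> k) * I (\<Phi> j) (\<Phi> k))"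
      by (simp add: D_def inner_diff_right inner_sum_right poly_inner_smult_right)
    also have "(\<Sum>k<n. I (\<Phi> k) g / I (\<Phi> k) (\<Phi> k) * I (\<Phi> j) (\<Phi> k))
        = (\<Sum>k<n. if k = j then I (\<Phi> j) g / I (\<Phi> j) (\<Phi> j) * I (\<Phi> j) (\<Phi> j) else 0)"
      by (intro sum.cong) (auto simp: orth)
    also have "\<dots> = I (\<Phi> j) g" using j inner_OP_self_nonzero[OF j] by simp
    finally show ?thesis by simp
  qed
  then have "I D D = 0" by (rule inner_deg_lt_eq_0[OF D_lt])
  then have "D = 0" by (rule inner_self_eq_0_imp[OF D_lt])
  then have "poly D z = 0" by simp
  then have "poly g z = (\<Sum>k<n. I (\<Phi> k) g / I (\<Phi> k) (\<Phi> k) * poly (\<Phi> k) z)"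
    by (simp add: D_def poly_sum)
  also have "\<dots> = (\<Sum>k<n. poly g z * of_real (m z * ((norm (poly (\<Phi> k) z))\<^sup>2 / N k)))"
  proof (intro sum.cong refl)
    fix k
    have "I (\<Phi> k) g = (\<Sum>y\<in>Z. if y = z then m z * (cnj (poly (\<Phi> k) z) * poly g z) else 0)"
      unfolding inner_eq by (intro sum.cong) (auto simp: gy)
    also have "\<dots> = m z * (cnj (poly (\<Phi> k) z) * poly g z)" using z finite_Z by simp
    finally show "I (\<Phi> k) g / I (\<Phi> k) (\<Phi> k) * poly (\<Phi> k) z
        = poly g z * of_real (m z * ((norm (poly (\<Phi> k) z))\<^sup>2 / N k))"
      unfolding inner_OP_self of_real_mult of_real_divide complex_norm_square by simp
  qed
  also have "\<dots> = poly g z * of_real (m z * (\<Sum>k<n. (norm (poly (\<Phi> k) z))\<^sup>2 / N k))"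
    by (simp add: sum_distrib_left)
  finally have "complex_of_real (m z * (\<Sum>k<n. (norm (poly (\<Phi> k) z))\<^sup>2 / N k)) = 1"
    using gz by simp
  then have "m z * (\<Sum>k<n. (norm (poly (\<Phi> k) z))\<^sup>2 / N k) = 1"
    by (simp only: of_real_eq_1_iff)
  then show ?thesis using atom_pos[OF z] by (simp add: field_simps)
qed

end

section \<open>The path parameter and the coefficient matrix\<close>

definition cvec :: "complex \<Rightarrow> real^2" where
  "cvec c = vector [Re c, Im c]"

lemma cvec_nth [simp]: "cvec c $ 1 = Re c" "cvec c $ 2 = Im c"
  by (simp_all add: cvec_def)

lemma bounded_linear_cvec: "bounded_linear cvec"
  by (rule linear_conv_bounded_linear[THEN iffD1], rule linearI)
    (auto simp: vec_eq_iff forall_2)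

lemma cvec_of_real_mult: "cvec (of_real r * c) = r *\<^sub>R cvec c"
  by (simp add: vec_eq_iff forall_2)

lemma inner_cvec:
  fixes a b :: complex
  shows "cvec a \<bullet> cvec b = Re (cnj a * b)"
  by (simp add: inner_vec_def sum_2)

lemma Jmat_cvec:
  fixes q :: complex
  shows "Jmat *v cvec q = cvec (\<i> * q)"
  by (simp add: vec_eq_iff forall_2 Jmat_def matrix_vector_mult_def sum_2)

lemma inj_on_cayley: "inj_on cayley closed_upper_half_plane"
proof (rule inj_onI)
  have nz: "w + \<i> \<noteq> 0" if "0 \<le> Im w" for w using that by (auto simp: complex_eq_iff)
  have n1: "w - \<i> \<noteq> w + \<i>" for w by (simp add: complex_eq_iff)
  fix x y assume "x \<in> closed_upper_half_plane" "y \<in> closed_upper_half_plane" "cayley x = cayley y"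
  then show "x = y"
    by (auto simp: closed_upper_half_plane_def cayley_def nz n1 field_simps split: option.splits)
qed

text \<open>The formula solves \<open>(z - \<i>) / (z + \<i>) = b\<close> for \<open>z\<close>.
  Boundary values \<open>norm b = 1\<close> are covered because the path ends on the circle.\<close>

lemma cayley_inverse:
  fixes b :: complex
  assumes b: "norm b \<le> 1" "b \<noteq> 1"
  shows "the_inv_into closed_upper_half_plane cayley b = Some (\<i> * (1 + b) / (1 - b))"
proof (rule the_inv_into_f_eq[OF inj_on_cayley])
  have nz: "1 - b \<noteq> 0" using b by simp
  have "\<i> * (1 + b) / (1 - b) - \<i> = \<i> * (2 * b) / (1 - b)"
    "\<i> * (1 + b) / (1 - b) + \<i> = \<i> * 2 / (1 - b)"
    using nz by (simp_all add: field_simps)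
  then show "cayley (Some (\<i> * (1 + b) / (1 - b))) = b"
    using nz by (simp add: cayley_def)
  have "Im (\<i> * (1 + b) / (1 - b)) = (1 - (norm b)\<^sup>2) / (norm (1 - b))\<^sup>2"
    by (simp add: complex_div_cnj[of "\<i> * (1 + b)"] cmod_power2)
      (simp add: power2_eq_square algebra_simps)
  then show "Some (\<i> * (1 + b) / (1 - b)) \<in> closed_upper_half_plane"
    using b by (simp add: closed_upper_half_plane_def power_le_one)
qed

lemma cayley_inverse_1: "the_inv_into closed_upper_half_plane cayley 1 = None"
  by (rule the_inv_into_f_eq[OF inj_on_cayley]) (auto simp: cayley_def closed_upper_half_plane_def)

text \<open>In the disk coordinate the matrix becomes a real multiple of \<open>q\<close> plus an
  antilinear term in \<open>q\<close>, a form into which \<open>b = B k / A k\<close> can be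
  substituted.\<close>

lemma Rmat_cvec:
  fixes b q :: complex
  assumes b: "norm b < 1"
  shows "Rmat (\<i> * (1 + b) / (1 - b)) *v cvec q
    = cvec (((1 + (norm b)\<^sup>2) * q - 2 * cnj (b * q)) / (2 * (1 - (norm b)\<^sup>2)))"
proof -
  define z where "z = \<i> * (1 + b) / (1 - b)"
  define d where "d = (norm (1 - b))\<^sup>2"
  define e where "e = 1 - (norm b)\<^sup>2"
  have "b \<noteq> 1" using b by auto
  then have d: "d > 0" by (simp add: d_def)
  have e: "e > 0" using b by (simp add: e_def abs_square_less_1)
  have d': "d = 1 + (norm b)\<^sup>2 - 2 * Re b"
    unfolding d_def cmod_power2 by (simp add: power2_eq_square algebra_simps)
  have y: "Im z = e / d" and x: "Re z = - 2 * Im b / d"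
    unfolding z_def d_def e_def
    by (simp_all add: complex_div_cnj[of "\<i> * (1 + b)"] cmod_power2)
      (simp_all add: power2_eq_square algebra_simps)
  have zz: "(Re z)\<^sup>2 + (Im z)\<^sup>2 = (1 + (norm b)\<^sup>2 + 2 * Re b) / d"
  proof -
    have "(Re z)\<^sup>2 + (Im z)\<^sup>2 = (norm (1 + b))\<^sup>2 / d"
      by (simp add: cmod_power2[symmetric] z_def d_def norm_divide norm_mult power_divide)
    also have "(norm (1 + b))\<^sup>2 = 1 + (norm b)\<^sup>2 + 2 * Re b"
      unfolding cmod_power2 by (simp add: power2_eq_square algebra_simps)
    finally show ?thesis .
  qed
  have R: "Rmat z $ 1 $ 1 = 1 / (2 * Im z)" "Rmat z $ 1 $ 2 = - Re z / (2 * Im z)"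
    "Rmat z $ 2 $ 1 = - Re z / (2 * Im z)" "Rmat z $ 2 $ 2 = ((Re z)\<^sup>2 + (Im z)\<^sup>2) / (2 * Im z)"
    by (simp_all add: Rmat_def Xmat_def det_2 transpose_def matrix_matrix_mult_def sum_2 power2_eq_square)
  have R': "Rmat z $ 1 $ 1 = (1 + (norm b)\<^sup>2 - 2 * Re b) / (2 * e)" "Rmat z $ 1 $ 2 = Im b / e"
    "Rmat z $ 2 $ 1 = Im b / e" "Rmat z $ 2 $ 2 = (1 + (norm b)\<^sup>2 + 2 * Re b) / (2 * e)"
    unfolding R zz unfolding x y d'[symmetric] using d e by (simp_all add: field_simps)
  have "Rmat z *v cvec q = cvec (((1 + (norm b)\<^sup>2) * q - 2 * cnj (b * q)) / of_real (2 * e))"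
    unfolding vec_eq_iff forall_2 cvec_nth Re_divide_of_real Im_divide_of_real
    using e by (simp add: matrix_vector_mult_def sum_2 R' field_simps)
  then show ?thesis by (simp add: z_def e_def)
qed

lemma det_Rmat:
  assumes "Im z > 0" shows "det (Rmat z) = 1 / 4"
  using assms by (simp add: det_2 Rmat_def Xmat_def transpose_def matrix_matrix_mult_def sum_2
      power2_eq_square field_simps)

lemma invertible_Rmat:
  fixes b :: complex
  assumes b: "norm b < 1"
  shows "invertible (Rmat (\<i> * (1 + b) / (1 - b)))"
proof -
  have "b \<noteq> 1" using b by auto
  moreover have "Im (\<i> * (1 + b) / (1 - b)) = (1 - (norm b)\<^sup>2) / (norm (1 - b))\<^sup>2"
    by (simp add: complex_div_cnj[of "\<i> * (1 + b)"] cmod_power2)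
      (simp add: power2_eq_square algebra_simps)
  ultimately show ?thesis
    using b by (simp add: invertible_det_nz det_Rmat abs_square_less_1)
qed

context circle_atoms
begin

section \<open>The entries of the Verblunsky products\<close>

definition A :: "nat \<Rightarrow> complex" where "A k = verblunsky_prod \<nu> k $ 2 $ 2"
definition B :: "nat \<Rightarrow> complex" where "B k = verblunsky_prod \<nu> k $ 1 $ 2"

lemma verblunsky_prod_conj:
  "verblunsky_prod \<nu> k $ 1 $ 1 = cnj (A k) \<and> verblunsky_prod \<nu> k $ 2 $ 1 = cnj (B k)"
  unfolding A_def B_def
  by (induction k) (simp_all add: mat_def matrix_matrix_mult_def sum_2)

lemma A_0: "A 0 = 1" and B_0: "B 0 = 0"
  by (simp_all add: A_def B_def mat_def)

lemma A_Suc: "A (Suc k) = A k + cnj (B k) * cnj (\<alpha> k)"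
  and B_Suc: "B (Suc k) = B k + cnj (A k) * cnj (\<alpha> k)"
  using verblunsky_prod_conj[of k]
  by (simp_all add: A_def B_def matrix_matrix_mult_def sum_2 add.commute)

text \<open>Determinants multiply, and by \<open>N_Suc\<close> the factor
  \<open>1 - \<alpha> k * cnj (\<alpha> k)\<close> of each step also takes \<open>N k\<close> to
  \<open>N (Suc k)\<close>.\<close>

lemma det_verblunsky_prod: "k \<le> n \<Longrightarrow> A k * cnj (A k) - B k * cnj (B k) = of_real (N k)"
proof (induction k)
  case (Suc k)
  have "A (Suc k) * cnj (A (Suc k)) - B (Suc k) * cnj (B (Suc k))
      = (A k * cnj (A k) - B k * cnj (B k)) * (1 - \<alpha> k * cnj (\<alpha> k))"
    by (simp add: A_Suc B_Suc algebra_simps)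
  also have "\<dots> = of_real (N (Suc k))"
    using Suc by (simp add: N_Suc complex_norm_square[symmetric])
  finally show ?case .
qed (simp add: A_0 B_0 N_0)

lemma norm_AB: "k \<le> n \<Longrightarrow> (norm (A k))\<^sup>2 - (norm (B k))\<^sup>2 = N k"
  using det_verblunsky_prod[of k]
  by (simp only: complex_norm_square[symmetric] of_real_diff[symmetric] of_real_eq_iff)

lemma card_pos: "0 < n"
  using N_0 N_card by (cases n) auto

text \<open>Below \<open>n\<close> the positivity of \<open>N k\<close> suffices. At
  \<open>n\<close>, where \<open>N n = 0\<close>, the last coefficient is unimodular;
  \<open>A n = 0\<close> would then force \<open>A\<close> and \<open>B\<close> at index
  \<open>n - 1\<close> to have equal modulus, against \<open>N (n - 1) > 0\<close>.\<close>

lemma A_nonzero: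
  assumes "k \<le> n" shows "A k \<noteq> 0"
proof (cases "k < n")
  case True
  then have "0 < (norm (A k))\<^sup>2"
    using norm_AB[OF assms] N_pos[OF True] zero_le_power2[of "norm (B k)"] by linarith
  then show ?thesis by auto
next
  case False
  then have k: "k = n" using assms by simp
  then obtain i where i: "k = Suc i" using card_pos not0_implies_Suc[of k] by auto
  have pos: "N i > 0" using k i N_pos by simp
  have "N (Suc i) = 0" using k i N_card by simp
  then have "(norm (\<alpha> i))\<^sup>2 = 1" using N_Suc[of i] pos k i by simp
  then have "norm (\<alpha> i) = 1" using power2_eq_1_iff by (smt (verit) norm_ge_zero)
  show ?thesis
  proof
    assume "A k = 0"
    then have "A i = - (cnj (B i) * cnj (\<alpha> i))"
      by (simp add: i A_Suc add_eq_0_iff2)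
    then have "norm (A i) = norm (B i)" using \<open>norm (\<alpha> i) = 1\<close> by (simp add: norm_mult)
    then show False using norm_AB[of i] pos k i by simp
  qed
qed

lemma path_b_eq: "path_b \<nu> k = B k / A k"
  by (simp add: path_b_def proj_ratio_def matrix_vector_mult_def sum_2 A_def B_def)

lemma norm_path_b:
  assumes "k \<le> n" shows "1 - (norm (path_b \<nu> k))\<^sup>2 = N k / (norm (A k))\<^sup>2"
  unfolding norm_AB[OF assms, symmetric] using A_nonzero[OF assms]
  by (simp add: path_b_eq norm_divide power_divide diff_divide_distrib)

lemma norm_path_b_less: "k < n \<Longrightarrow> norm (path_b \<nu> k) < 1"
  using norm_path_b[of k] N_pos[of k] A_nonzero[of k]
  by (smt (verit) less_imp_le_nat divide_pos_pos norm_ge_zero one_le_power zero_less_norm_iff zero_less_power)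

lemma norm_path_b_card: "norm (path_b \<nu> n) = 1"
  using norm_path_b[of n] N_card by (simp add: power2_eq_1_iff) (smt (verit) norm_ge_zero)

abbreviation "Rk k \<equiv> Rmat (the (path_z \<nu> k))"

lemma path_z_eq: "k < n \<Longrightarrow> the (path_z \<nu> k) = \<i> * (1 + path_b \<nu> k) / (1 - path_b \<nu> k)"
  unfolding path_z_def using norm_path_b_less[of k] by (subst cayley_inverse) auto

lemma invertible_Rk: "k < n \<Longrightarrow> invertible (Rk k)"
  by (simp add: path_z_eq invertible_Rmat norm_path_b_less)

text \<open>The real vector \<open>v\<close> is encoded as \<open>q = v\<^sub>1 + \<i> v\<^sub>2\<close>. The coordinate \<open>P = A q\<^sup>* - B q\<close> diagonalises
  the Dirac equation on the \<open>k\<close>-th piece, and \<open>sol k\<close> recovers \<open>q\<close> from \<open>P\<close>.\<close>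

definition sol :: "nat \<Rightarrow> complex \<Rightarrow> complex" where
  "sol k P = (A k * cnj P + cnj (B k) * P) / of_real (N k)"

lemma bounded_linear_sol: "bounded_linear (sol k)"
  by (rule linear_conv_bounded_linear[THEN iffD1], rule linearI)
    (simp_all add: sol_def add_divide_distrib scaleR_conv_of_real algebra_simps)

lemma sol_inverse:
  assumes "k < n" shows "A k * cnj (sol k P) - B k * sol k P = P"
proof -
  have "A k * cnj (sol k P) - B k * sol k P
      = (A k * cnj (A k) - B k * cnj (B k)) * P / of_real (N k)"
    by (simp add: sol_def diff_divide_distrib[symmetric] algebra_simps)
  then show ?thesis using det_verblunsky_prod[of k] N_pos[of k] assms by simp
qed

text \<open>Passing to the next piece multiplies numerator and denominator by the same factor, so
  \<open>q\<close> is unchanged; this makes the solution continuous at the grid points. Index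
  \<open>n\<close> is excluded because \<open>N n = 0\<close>.\<close>

lemma sol_Suc:
  assumes "Suc k < n"
  shows "sol (Suc k) (P - cnj (\<alpha> k) * cnj P) = sol k P"
proof -
  have "A (Suc k) * cnj (P - cnj (\<alpha> k) * cnj P) + cnj (B (Suc k)) * (P - cnj (\<alpha> k) * cnj P)
     = (A k * cnj P + cnj (B k) * P) * (1 - \<alpha> k * cnj (\<alpha> k))"
    by (simp add: A_Suc B_Suc algebra_simps)
  moreover have "complex_of_real (N (Suc k)) = of_real (N k) * (1 - \<alpha> k * cnj (\<alpha> k))"
    using assms by (simp add: N_Suc complex_norm_square[symmetric])
  moreover have "complex_of_real (N (Suc k)) \<noteq> 0" using N_pos[OF assms] by simp
  ultimately show ?thesis unfolding sol_def by simp
qed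

text \<open>Up to the factor 1/2, the matrix only flips the sign of the \<open>cnj (B k) * P\<close>
  part of \<open>sol k P\<close>.\<close>

lemma Rk_sol:
  assumes k: "k < n"
  shows "Rk k *v cvec (sol k P) = cvec ((A k * cnj P - cnj (B k) * P) / of_real (2 * N k))"
proof -
  define q where "q = sol k P"
  define b where "b = path_b \<nu> k"
  have A: "A k \<noteq> 0" using A_nonzero k by simp
  have N: "complex_of_real (N k) \<noteq> 0" using N_pos[OF k] by simp
  have det: "A k * cnj (A k) - B k * cnj (B k) = of_real (N k)"
    using det_verblunsky_prod k by simp
  have b: "b = B k / A k" by (simp add: b_def path_b_eq)
  have e: "1 - b * cnj b = of_real (N k) / (A k * cnj (A k))"
    unfolding det[symmetric] using A by (simp add: b diff_divide_distrib)
  have q: "of_real (N k) * q = A k * cnj P + cnj (B k) * P"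
    and q': "of_real (N k) * cnj q = cnj (A k) * P + B k * cnj P"
    using N by (simp_all add: q_def sol_def)
  \<comment> \<open>Multiplying by \<open>N k\<close> allows \<open>q\<close> and
    \<open>cnj q\<close> to be replaced by their numerators; the determinant then comes out as a
    factor and cancels against \<open>N k\<close>.\<close>
  have "of_real (N k) * ((A k * cnj (A k) + B k * cnj (B k)) * q - 2 * (cnj (B k) * A k) * cnj q)
     = (A k * cnj (A k) + B k * cnj (B k)) * (of_real (N k) * q) - 2 * (cnj (B k) * A k) * (of_real (N k) * cnj q)"
    by (simp add: algebra_simps)
  also have "\<dots> = (A k * cnj (A k) - B k * cnj (B k)) * (A k * cnj P - cnj (B k) * P)"
    unfolding q q' by (simp add: algebra_simps)
  finally have *: "(A k * cnj (A k) + B k * cnj (B k)) * q - 2 * (cnj (B k) * A k) * cnj q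
      = A k * cnj P - cnj (B k) * P"
    using N unfolding det by simp
  have "((1 + b * cnj b) * q - 2 * cnj (b * q)) / (2 * (1 - b * cnj b))
      = ((A k * cnj (A k) + B k * cnj (B k)) * q - 2 * (cnj (B k) * A k) * cnj q) / (2 * of_real (N k))"
    unfolding e using A N by (simp add: b field_simps)
  then have "((1 + complex_of_real ((norm b)\<^sup>2)) * q - 2 * cnj (b * q)) / complex_of_real (2 * (1 - (norm b)\<^sup>2))
      = (A k * cnj P - cnj (B k) * P) / of_real (2 * N k)"
    unfolding * of_real_mult of_real_diff complex_norm_square by simp
  then show ?thesis
    using Rmat_cvec[OF norm_path_b_less[OF k], where q = q]
    by (simp only: path_z_eq[OF k] b_def q_def of_real_add of_real_1)
qed

text \<open>The mixed terms of the product are a number minus its conjugate and drop out of the real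
  part; the determinant \<open>N k\<close> cancels one of the two denominators.\<close>

lemma quadratic_form_sol:
  assumes k: "k < n"
  shows "cvec (sol k P) \<bullet> (Rk k *v cvec (sol k P)) = (norm P)\<^sup>2 / (2 * N k)"
proof -
  have N: "N k > 0" using N_pos[OF k] .
  have det: "(norm (A k))\<^sup>2 - (norm (B k))\<^sup>2 = N k" using norm_AB k by simp
  have "Re ((cnj (A k) * P + B k * cnj P) * (A k * cnj P - cnj (B k) * P))
     = ((norm (A k))\<^sup>2 - (norm (B k))\<^sup>2) * (norm P)\<^sup>2"
    unfolding cmod_power2 by (simp add: power2_eq_square algebra_simps)
  then have "Re (cnj (sol k P) * ((A k * cnj P - cnj (B k) * P) / of_real (2 * N k)))
     = N k * (norm P)\<^sup>2 / (N k * (2 * N k))"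
    unfolding sol_def det
    by (simp only: complex_cnj_divide complex_cnj_add complex_cnj_mult complex_cnj_cnj complex_cnj_complex_of_real
        times_divide_times_eq of_real_mult[symmetric] Re_divide_of_real)
  then show ?thesis unfolding Rk_sol[OF k] inner_cvec using N by simp
qed

text \<open>The hypothesis is \<open>cnj q = b * q\<close> with \<open>b\<close> the last path
  parameter, which lies on the circle. For \<open>b = 1\<close> the end point is infinity and
  \<open>q\<close> is real; otherwise the inverse Cayley transform \<open>z\<close> of
  \<open>b\<close> satisfies \<open>z * of_real (Im q) = of_real (Re q)\<close>.\<close>

lemma bdry_u1_sol:
  fixes q :: complex
  assumes "A n * cnj q = B n * q"
  shows "cvec q \<bullet> (Jmat *v bdry_u1 \<nu> n) = 0"
proof -
  define b where "b = path_b \<nu> n"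
  have q: "cnj q = b * q"
    using assms A_nonzero[of n] by (simp add: b_def path_b_eq field_simps)
  show ?thesis
  proof (cases "b = 1")
    case True
    then have "Im q = 0" using q by (simp add: complex_eq_iff)
    then show ?thesis using True
      by (simp add: bdry_u1_def path_z_def b_def cayley_inverse_1 Jmat_def inner_vec_def sum_2
          matrix_vector_mult_def)
  next
    case False
    define z where "z = \<i> * (1 + b) / (1 - b)"
    have z: "path_z \<nu> n = Some z"
      unfolding path_z_def z_def using False norm_path_b_card
      by (simp add: b_def cayley_inverse)
    have Im: "of_real (Im q) = (q - b * q) / (2 * \<i>)" and Re: "of_real (Re q) = (q + b * q) / 2"
      unfolding q[symmetric] by (simp_all add: complex_eq_iff)
    have "z * of_real (Im q) = of_real (Re q)"
      unfolding Im Re z_def using False by (simp add: field_simps)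
    then have "Re (z * of_real (Im q)) = Re q" by simp
    then show ?thesis
      by (simp add: bdry_u1_def z Jmat_def inner_vec_def sum_2 matrix_vector_mult_def mult.commute)
  qed
qed

end

section \<open>Eigenvalues of Dirac operators\<close>

lemma dirac_op_eq_iff:
  assumes "invertible (R t)"
  shows "dirac_op R v t = w \<longleftrightarrow> Jmat *v vector_derivative v (at t) = R t *v w"
proof -
  have inv: "R t ** matrix_inv (R t) = mat 1" "matrix_inv (R t) ** R t = mat 1"
    using someI_ex[OF assms[unfolded invertible_def]] by (auto simp: matrix_inv_def)
  show ?thesis
  proof
    assume "dirac_op R v t = w"
    then have "R t *v w = (R t ** matrix_inv (R t)) *v (Jmat *v vector_derivative v (at t))"
      by (simp only: dirac_op_def matrix_vector_mul_assoc[symmetric])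
    then show "Jmat *v vector_derivative v (at t) = R t *v w" by (simp add: inv)
  next
    assume "Jmat *v vector_derivative v (at t) = R t *v w"
    then have "dirac_op R v t = (matrix_inv (R t) ** R t) *v w"
      by (simp add: dirac_op_def matrix_vector_mul_assoc)
    then show "dirac_op R v t = w" by (simp add: inv)
  qed
qed

lemma Jmat_mult_eq_iff: "Jmat *v a = b \<longleftrightarrow> a = - (Jmat *v b)"
  by (auto simp: vec_eq_iff forall_2 Jmat_def matrix_vector_mult_def sum_2)

lemma norm_R_cmult:
  assumes "\<And>t. t \<in> {0..<1} \<Longrightarrow> h t = c *\<^sub>R f t"
  shows "norm_R R h = \<bar>c\<bar> * norm_R R f"
proof -
  have "(LINT s|lebesgue_on {0..<1}. h s \<bullet> (R s *v h s))
      = (LINT s|lebesgue_on {0..<1}. c\<^sup>2 * (f s \<bullet> (R s *v f s)))"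
    by (intro Bochner_Integration.integral_cong)
      (auto simp: assms scaleR_matrix_vector_assoc[symmetric] matrix_vector_mult_scaleR power2_eq_square)
  then show ?thesis
    by (simp add: norm_R_def real_sqrt_mult)
qed

text \<open>An eigenfunction of positive norm violates the lower bound required in the resolvent
  set, whatever the constant, since the right-hand side is 0.\<close>

lemma dirac_spectrum_eigenvalue:
  assumes f: "is_eigenfunction R u0 u1 \<mu> f" and pos: "0 < norm_R R f"
  shows "\<mu> \<in> dirac_spectrum R u0 u1"
proof -
  have "AE t in lebesgue_on {0..<1}. dirac_op R f t = \<mu> *\<^sub>R f t"
    using f by (simp add: is_eigenfunction_def)
  then have "AE t in lebesgue_on {0..<1}.
      (dirac_op R f t - \<mu> *\<^sub>R f t) \<bullet> (R t *v (dirac_op R f t - \<mu> *\<^sub>R f t)) = 0"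
    by eventually_elim simp
  then have "(LINT t|lebesgue_on {0..<1}.
      (dirac_op R f t - \<mu> *\<^sub>R f t) \<bullet> (R t *v (dirac_op R f t - \<mu> *\<^sub>R f t))) = 0"
    by (rule integral_eq_zero_AE)
  then have "norm_R R (\<lambda>t. dirac_op R f t - \<mu> *\<^sub>R f t) = 0"
    by (simp add: norm_R_def)
  moreover have "f \<in> dirac_dom R u0 u1" using f by (simp add: is_eigenfunction_def)
  ultimately show ?thesis using pos by (fastforce simp: dirac_spectrum_def)
qed

text \<open>\<open>SOME\<close> picks an unknown eigenfunction, but it is a nonzero multiple of
  \<open>f\<close>, and the quotient is invariant under scaling.\<close>

lemma left_weight_eq:
  assumes f: "is_eigenfunction R u0 u1 \<mu> f"
    and unique: "\<And>h. is_eigenfunction R u0 u1 \<mu> h \<Longrightarrow> \<exists>c. \<forall>t\<in>{0..1}. h t = c *\<^sub>R f t"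
  shows "left_weight R u0 u1 \<mu> = (f 0 \<bullet> f 0) / (norm_R R f)\<^sup>2"
proof -
  define h where "h = (SOME f. is_eigenfunction R u0 u1 \<mu> f)"
  have h: "is_eigenfunction R u0 u1 \<mu> h" unfolding h_def by (rule someI[where P = "is_eigenfunction R u0 u1 \<mu>", OF f])
  then obtain c where c: "\<And>t. t \<in> {0..1} \<Longrightarrow> h t = c *\<^sub>R f t"
    using unique by blast
  have "\<not> (AE t in lebesgue_on {0..<1}. h t = 0)" using h by (simp add: is_eigenfunction_def)
  then have "c \<noteq> 0" using c by (auto simp: AE_restrict_space_iff)
  moreover have "(norm_R R h)\<^sup>2 = c\<^sup>2 * (norm_R R f)\<^sup>2"
    by (subst norm_R_cmult[of h c f]) (auto simp: c power_mult_distrib)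
  moreover have "h 0 \<bullet> h 0 = c\<^sup>2 * (f 0 \<bullet> f 0)" by (simp add: c power2_eq_square)
  ultimately show ?thesis
    by (simp add: left_weight_def h_def[symmetric])
qed

lemma emeasure_left_spectral_measure_singleton:
  assumes "\<mu> \<in> dirac_spectrum R u0 u1"
  shows "emeasure (left_spectral_measure R u0 u1) {\<mu>} = ennreal (left_weight R u0 u1 \<mu>)"
proof -
  have "emeasure (left_spectral_measure R u0 u1) {\<mu>}
      = emeasure (density (count_space (dirac_spectrum R u0 u1)) (\<lambda>\<mu>. ennreal (left_weight R u0 u1 \<mu>))) {\<mu>}"
    unfolding left_spectral_measure_def using assms
    by (subst emeasure_distr) (auto simp: measurable_def intro!: arg_cong2[of _ _ _ _ emeasure])
  also have "\<dots> = (\<integral>\<^sup>+x. ennreal (left_weight R u0 u1 \<mu>) * indicator {\<mu>} x \<partial>count_space (dirac_spectrum R u0 u1))"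
    using assms by (subst emeasure_density) (auto intro!: nn_integral_cong simp: indicator_def)
  also have "\<dots> = ennreal (left_weight R u0 u1 \<mu>)"
    using assms by (simp add: nn_integral_cmult_indicator emeasure_count_space)
  finally show ?thesis .
qed

section \<open>The eigenfunction at an atom\<close>

text \<open>All eigenvalues belonging to one atom are treated at once: \<open>exp_\<mu>\<close>
  determines \<open>\<mu>\<close> up to integer multiples of \<open>2 * pi * n\<close>.\<close>

locale circle_eigenvalue = circle_atoms +
  fixes z :: complex and \<mu> :: real
  assumes z: "z \<in> Z" and exp_\<mu>: "exp (\<i> * of_real (\<mu> / n)) = z"
begin

text \<open>On the circle \<open>cnj z ^ k\<close> is the inverse of \<open>z ^ k\<close>; it
  compensates for the factor \<open>z\<close> that every Szego step brings in.\<close>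

definition P :: "nat \<Rightarrow> real \<Rightarrow> complex" where
  "P k t = exp (\<i> * of_real (\<mu> / 2) * of_real t) * (cnj z ^ k * poly (\<Phi> k) z)"

definition piece :: "nat \<Rightarrow> real \<Rightarrow> real^2" where
  "piece k t = cvec (sol k (P k t))"

definition piece' :: "nat \<Rightarrow> real \<Rightarrow> real^2" where
  "piece' k t = cvec (sol k (\<i> * of_real (\<mu> / 2) * P k t))"

text \<open>The last piece is continued to the right end point, where \<open>\<lfloor>n t\<rfloor> = n\<close>.\<close>

definition eigenfn :: "real \<Rightarrow> real^2" where
  "eigenfn t = piece (min (nat \<lfloor>real n * t\<rfloor>) (n - 1)) t"

lemma cnj_z: "cnj z * z = 1"
  using complex_norm_square[of z] norm_Z[OF z] by (simp add: mult.commute)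

lemma norm_P: "norm (P k t) = norm (poly (\<Phi> k) z)"
  using norm_Z[OF z] by (simp add: P_def norm_mult norm_power)

text \<open>At the right end of piece \<open>k\<close> the squared phase \<open>E * E\<close> is
  \<open>z ^ Suc k\<close>, hence \<open>E * cnj z ^ Suc k = cnj E\<close>. This turns the
  \<open>\<Psi> k\<close> term of the Szego recursion into a multiple of
  \<open>cnj (P k t)\<close>.\<close>

lemma P_Suc:
  assumes k: "k < n" and t: "t = real (Suc k) / n"
  shows "P (Suc k) t = P k t - cnj (\<alpha> k) * cnj (P k t)"
proof -
  define E where "E = exp (\<i> * of_real (\<mu> / 2) * of_real t)"
  have "E * E = exp (\<i> * of_real (\<mu> * t))"
    unfolding E_def exp_add[symmetric] by simp
  also have "\<i> * of_real (\<mu> * t) = of_nat (Suc k) * (\<i> * of_real (\<mu> / n))"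
    unfolding t by (simp del: of_nat_Suc)
  also have "exp \<dots> = z ^ Suc k" unfolding exp_of_nat_mult exp_\<mu> ..
  finally have EE: "E * E = z ^ Suc k" .
  have E1: "cnj E * E = 1"
    using complex_norm_square[of E] by (simp add: E_def mult.commute)
  have zk: "cnj z ^ i * z ^ i = 1" for i
    using cnj_z by (simp add: power_mult_distrib[symmetric])
  have "E * cnj z ^ Suc k = cnj E * (E * E) * cnj z ^ Suc k"
    using E1 by (simp add: mult.assoc[symmetric])
  also have "\<dots> = cnj E * (cnj z ^ Suc k * z ^ Suc k)" unfolding EE by (simp add: mult_ac)
  finally have E2: "E * cnj z ^ Suc k = cnj E" unfolding zk by simp
  have "poly (\<Phi> (Suc k)) z = z * poly (\<Phi> k) z - cnj (\<alpha> k) * (z ^ k * cnj (poly (\<Phi> k) z))"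
    by (simp add: szego_recursion[OF k] poly_reversed_OP norm_Z[OF z])
  then have "P (Suc k) t = E * (cnj z ^ Suc k * (z * poly (\<Phi> k) z - cnj (\<alpha> k) * (z ^ k * cnj (poly (\<Phi> k) z))))"
    unfolding P_def E_def[symmetric] by simp
  also have "\<dots> = E * cnj z ^ k * (cnj z * z) * poly (\<Phi> k) z
      - cnj (\<alpha> k) * (E * cnj z ^ Suc k) * (z ^ k * cnj (poly (\<Phi> k) z))"
    by (simp add: algebra_simps)
  also have "\<dots> = P k t - cnj (\<alpha> k) * cnj (P k t)"
    unfolding E2 cnj_z P_def E_def[symmetric] by (simp add: mult_ac)
  finally show ?thesis .
qed

lemma piece_Suc:
  assumes "Suc k < n" and "t = real (Suc k) / n"
  shows "piece (Suc k) t = piece k t"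
  using assms by (simp add: piece_def P_Suc sol_Suc del: of_nat_Suc)

lemma piece_has_vector_derivative: "(piece k has_vector_derivative piece' k t) (at t within S)"
proof -
  have "((\<lambda>w. exp (\<i> * of_real (\<mu> / 2) * w) * (cnj z ^ k * poly (\<Phi> k) z))
      has_field_derivative \<i> * of_real (\<mu> / 2) * P k t) (at (of_real t))"
    by (auto intro!: derivative_eq_intros simp: P_def)
  then have "(P k has_vector_derivative \<i> * of_real (\<mu> / 2) * P k t) (at t within S)"
    unfolding P_def[abs_def] by (rule has_vector_derivative_real_field)
  then show ?thesis
    unfolding piece_def[abs_def] piece'_def
    by (intro bounded_linear.has_vector_derivative[OF bounded_linear_cvec]
        bounded_linear.has_vector_derivative[OF bounded_linear_sol])
qed

lemma lipschitz_on_piece: "\<exists>L. L-lipschitz_on {0..1} (piece k)"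
proof -
  obtain K where K: "\<And>w. norm (cvec (sol k w)) \<le> norm w * K"
    using bounded_linear.bounded[OF bounded_linear_compose[OF bounded_linear_cvec bounded_linear_sol]]
    by blast
  \<comment> \<open>The modulus of \<open>P k t\<close> does not depend on \<open>t\<close>, so its
    value at 0 bounds the derivative everywhere.\<close>
  define L where "L = \<bar>norm (\<i> * of_real (\<mu> / 2) * P k 0) * K\<bar>"
  have "L-lipschitz_on {0..1} (piece k)"
  proof (rule bounded_derivative_imp_lipschitz)
    show "(piece k has_derivative (\<lambda>h. h *\<^sub>R piece' k t)) (at t within {0..1})" for t
      using piece_has_vector_derivative by (simp add: has_vector_derivative_def)
    fix t
    have "norm (piece' k t) \<le> norm (\<i> * of_real (\<mu> / 2) * P k 0) * K"
      using K[of "\<i> * of_real (\<mu> / 2) * P k t"] by (simp add: piece'_def norm_mult norm_P)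
    then have le: "norm (piece' k t) \<le> L" unfolding L_def by linarith
    show "onorm (\<lambda>h. h *\<^sub>R piece' k t) \<le> L"
    proof (rule onorm_le)
      fix h :: real
      show "norm (h *\<^sub>R piece' k t) \<le> L * norm h"
        using mult_right_mono[OF le abs_ge_zero[of h]] by (simp add: mult.commute)
    qed
  qed (auto simp: L_def)
  then show ?thesis ..
qed

text \<open>Differentiation multiplies \<open>P\<close> by an imaginary number, which enters the
  linear and the antilinear part of \<open>sol\<close> with opposite signs. This is the sign flip of
  \<open>Rk_sol\<close>, and the factor 1/2 there is the reason for the speed
  \<open>\<mu> / 2\<close>.\<close>

lemma Jmat_piece':
  assumes "k < n" shows "Jmat *v piece' k t = Rk k *v (\<mu> *\<^sub>R piece k t)"
proof -
  have "\<i> * sol k (\<i> * of_real (\<mu> / 2) * P k t)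
      = of_real \<mu> * ((A k * cnj (P k t) - cnj (B k) * P k t) / of_real (2 * N k))"
    by (simp add: sol_def field_simps)
  then show ?thesis
    using Rk_sol[OF assms, of "P k t"]
    by (simp only: piece'_def piece_def Jmat_cvec matrix_vector_mult_scaleR cvec_of_real_mult)
qed

section \<open>Gluing the pieces along the grid\<close>

lemma grid_index:
  assumes "t \<in> {0..<1}" shows "\<exists>k<n. real k / n \<le> t \<and> t < real (Suc k) / n"
proof (intro exI[of _ "nat \<lfloor>real n * t\<rfloor>"] conjI)
  have n: "real n > 0" using card_pos by simp
  have t: "0 \<le> real n * t" "real n * t < real n" using assms n by auto
  have "real (nat \<lfloor>real n * t\<rfloor>) = of_int \<lfloor>real n * t\<rfloor>" using t by simp
  then have fl: "real (nat \<lfloor>real n * t\<rfloor>) \<le> real n * t" "real n * t < real (nat \<lfloor>real n * t\<rfloor>) + 1"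
    by linarith+
  show "nat \<lfloor>real n * t\<rfloor> < n" using fl t by linarith
  show "real (nat \<lfloor>real n * t\<rfloor>) / n \<le> t" "t < real (Suc (nat \<lfloor>real n * t\<rfloor>)) / n"
    using fl n by (auto simp: field_simps)
qed

lemma floor_grid:
  assumes "real k / n \<le> t" and "t < real (Suc k) / n"
  shows "nat \<lfloor>real n * t\<rfloor> = k"
proof -
  have "\<lfloor>real n * t\<rfloor> = int k"
    using assms card_pos by (intro floor_unique) (auto simp: field_simps)
  then show ?thesis by simp
qed

lemma measure_R_eq:
  "real k / n \<le> t \<Longrightarrow> t < real (Suc k) / n \<Longrightarrow> measure_R \<nu> n t = Rk k"
  by (simp only: measure_R_def floor_grid)

text \<open>At the right end of the interval the floor is already \<open>Suc k\<close>: there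
  \<open>piece_Suc\<close> identifies the neighbouring pieces, and for the last piece the
  \<open>min\<close> in \<open>eigenfn\<close> keeps the index at \<open>n - 1\<close>.\<close>

lemma eigenfn_eq:
  assumes k: "k < n" and t: "real k / n \<le> t" "t \<le> real (Suc k) / n"
  shows "eigenfn t = piece k t"
proof (cases "t = real (Suc k) / n")
  case True
  then have "nat \<lfloor>real n * t\<rfloor> = Suc k" using card_pos by simp
  moreover have "n - 1 = k" if "\<not> Suc k < n" using that k by simp
  ultimately show ?thesis
    using piece_Suc[OF _ True] k by (cases "Suc k < n") (auto simp: eigenfn_def min_def)
next
  case False
  then show ?thesis using floor_grid[of k t] t k by (simp add: eigenfn_def)
qed

lemma lipschitz_on_eigenfn: "\<exists>L. L-lipschitz_on {0..1} eigenfn"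
proof -
  have "\<forall>k. \<exists>L. L-lipschitz_on {0..1} (piece k)" using lipschitz_on_piece by blast
  then obtain L :: "nat \<Rightarrow> real" where L: "\<And>k. (L k)-lipschitz_on {0..1} (piece k)" by metis
  have L0: "0 \<le> L k" for k using L by (rule lipschitz_on_nonneg)
  \<comment> \<open>The sum is a common upper bound for the constants of all pieces.\<close>
  have "(\<Sum>k<n. L k)-lipschitz_on {0..1} eigenfn"
  proof (rule lipschitz_on_closed_Union)
    show "(\<Sum>k<n. L k)-lipschitz_on {real k / n..real (Suc k) / n} eigenfn" if k: "k \<in> {..<n}" for k
    proof -
      have "L k \<le> (\<Sum>k<n. L k)" using k L0 by (intro member_le_sum) auto
      moreover have "real (Suc k) / n \<le> 1" using k by simp
      then have "{real k / n..real (Suc k) / n} \<subseteq> {0..1}"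
        by (auto intro: order_trans divide_nonneg_nonneg)
      ultimately have "(\<Sum>k<n. L k)-lipschitz_on {real k / n..real (Suc k) / n} (piece k)"
        by (intro lipschitz_on_mono[OF L])
      then show ?thesis
        using k by (simp add: lipschitz_on_def eigenfn_eq)
    qed
    show "{0..1} \<subseteq> (\<Union>k\<in>{..<n}. {real k / n..real (Suc k) / n})"
    proof
      fix t :: real assume "t \<in> {0..1}"
      then consider "t \<in> {0..<1}" | "t = 1" by force
      then show "t \<in> (\<Union>k\<in>{..<n}. {real k / n..real (Suc k) / n})"
      proof cases
        case 1
        then show ?thesis using grid_index by (force intro: less_imp_le)
      next
        case 2
        then show ?thesis using card_pos by (auto intro!: bexI[of _ "n - 1"] simp: of_nat_diff field_simps)
      qed
    qed
  qed (use L0 in \<open>auto intro: sum_nonneg\<close>)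
  then show ?thesis ..
qed

text \<open>The possible jumps of the coefficient matrix and both end points: a finite, hence null,
  set outside which the equation holds pointwise.\<close>

definition grid :: "real set" where "grid = (\<lambda>k. real k / n) ` {..n}"

lemma grid_interval:
  assumes t: "t \<in> {0..1} - grid"
  shows "\<exists>k<n. real k / n < t \<and> t < real (Suc k) / n"
proof -
  have "1 \<in> grid" using card_pos by (auto simp: grid_def intro!: image_eqI[of _ _ n])
  then have "t \<in> {0..<1}" using t by (auto simp: less_le)
  then obtain k where "k < n" "real k / n \<le> t" "t < real (Suc k) / n" using grid_index by blast
  moreover have "t \<noteq> real k / n" using t \<open>k < n\<close> by (auto simp: grid_def)
  ultimately show ?thesis by (auto simp: less_le)
qed

lemma eigenfn_has_vector_derivative:
  assumes k: "k < n" and t: "real k / n < t" "t < real (Suc k) / n"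
  shows "(eigenfn has_vector_derivative piece' k t) (at t)"
  using piece_has_vector_derivative
proof (rule has_vector_derivative_transform_within_open)
  show "t \<in> {real k / n<..<real (Suc k) / n}" using t by simp
qed (use k eigenfn_eq in \<open>auto simp del: of_nat_Suc\<close>)

lemma dirac_op_eigenfn:
  assumes "t \<in> {0..1} - grid"
  shows "dirac_op (measure_R \<nu> n) eigenfn t = \<mu> *\<^sub>R eigenfn t"
proof -
  obtain k where k: "k < n" "real k / n < t" "t < real (Suc k) / n"
    using grid_interval[OF assms] by blast
  have R: "measure_R \<nu> n t = Rk k" using k by (intro measure_R_eq) auto
  have "vector_derivative eigenfn (at t) = piece' k t"
    using eigenfn_has_vector_derivative[OF k] by (rule vector_derivative_at)
  then show ?thesis
    using k by (subst dirac_op_eq_iff) (simp_all add: R invertible_Rk Jmat_piece' eigenfn_eq)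
qed

lemma finite_grid: "finite grid" by (simp add: grid_def)

lemma AE_not_grid: "AE t in lebesgue_on {0..<1}. t \<in> {0..1} - grid"
proof -
  have "AE t in lebesgue. t \<notin> grid"
    using finite_grid by (auto simp: eventually_ae_filter_negligible intro!: negligible_finite)
  then show ?thesis by (auto simp: AE_restrict_space_iff)
qed

lemma eigenfn_measurable: "eigenfn \<in> borel_measurable (lebesgue_on {0..<1})"
proof -
  have "continuous_on {0..1} eigenfn"
    using lipschitz_on_eigenfn lipschitz_on_continuous_on by blast
  then have "continuous_on {0..<1} eigenfn" by (rule continuous_on_subset) auto
  then show ?thesis by (rule continuous_imp_measurable_on_sets_lebesgue) auto
qed

section \<open>The norm of the eigenfunction\<close>

lemma quadratic_form_eigenfn:
  assumes s: "s \<in> {0..<1}"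
  shows "eigenfn s \<bullet> (measure_R \<nu> n s *v eigenfn s)
    = (\<Sum>k<n. indicator {real k / n..<real (Suc k) / n} s * ((norm (poly (\<Phi> k) z))\<^sup>2 / (2 * N k)))"
proof -
  obtain k where k: "k < n" "real k / n \<le> s" "s < real (Suc k) / n"
    using grid_index[OF s] by blast
  have "eigenfn s \<bullet> (measure_R \<nu> n s *v eigenfn s) = (norm (poly (\<Phi> k) z))\<^sup>2 / (2 * N k)"
    using k quadratic_form_sol[OF k(1)]
    by (simp add: measure_R_eq eigenfn_eq piece_def norm_P del: of_nat_Suc)
  also have "\<dots> = (\<Sum>i<n. if i = k then (norm (poly (\<Phi> i) z))\<^sup>2 / (2 * N i) else 0)"
    using k by simp
  also have "\<dots> = (\<Sum>k<n. indicator {real k / n..<real (Suc k) / n} s * ((norm (poly (\<Phi> k) z))\<^sup>2 / (2 * N k)))"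
    using floor_grid[of _ s] k by (intro sum.cong) (auto simp: indicator_def simp del: of_nat_Suc)
  finally show ?thesis .
qed

text \<open>The integrand is constant on each of the \<open>n\<close> intervals of length
  \<open>1 / n\<close>, so the integral is a multiple of the Christoffel sum.\<close>

lemma has_integral_quadratic_form_eigenfn:
  "has_bochner_integral (lebesgue_on {0..<1}) (\<lambda>s. eigenfn s \<bullet> (measure_R \<nu> n s *v eigenfn s))
    (1 / (2 * n * m z))"
proof -
  have ind: "has_bochner_integral (lebesgue_on {0..<1})
      (indicator {real k / n..<real (Suc k) / n} :: real \<Rightarrow> real) (1 / n)"
    if k: "k < n" for k
  proof -
    let ?S = "{real k / n..<real (Suc k) / n}"
    have sub: "?S \<subseteq> {0..<1}" using k by (auto simp: field_simps)
    then have meas: "?S \<in> sets (lebesgue_on {0..<1})" by (simp add: sets_restrict_space_iff)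
    have le: "real k / n \<le> real (Suc k) / n" by (simp add: divide_right_mono)
    have em: "emeasure (lebesgue_on {0..<1}) ?S = ennreal (1 / n)"
      using sub le by (simp add: emeasure_restrict_space diff_divide_distrib[symmetric])
    then have "measure (lebesgue_on {0..<1}) ?S = 1 / n" by (simp add: measure_def)
    then show ?thesis
      using has_bochner_integral_real_indicator[OF meas] em by simp
  qed
  have "has_bochner_integral (lebesgue_on {0..<1})
     (\<lambda>s. \<Sum>k<n. indicator {real k / n..<real (Suc k) / n} s * ((norm (poly (\<Phi> k) z))\<^sup>2 / (2 * N k)))
     (\<Sum>k<n. 1 / n * ((norm (poly (\<Phi> k) z))\<^sup>2 / (2 * N k)))"
    by (intro has_bochner_integral_sum has_bochner_integral_mult_left ind) auto
  also have "(\<Sum>k<n. 1 / n * ((norm (poly (\<Phi> k) z))\<^sup>2 / (2 * N k)))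
      = 1 / (2 * n) * (\<Sum>k<n. (norm (poly (\<Phi> k) z))\<^sup>2 / N k)"
    by (simp add: sum_distrib_left field_simps)
  also have "\<dots> = 1 / (2 * n * m z)"
    using christoffel[OF z] by simp
  finally show ?thesis
    by (rule has_bochner_integral_cong[THEN iffD1, rotated -1])
      (simp_all add: quadratic_form_eigenfn del: of_nat_Suc)
qed

lemma norm_R_eigenfn: "(norm_R (measure_R \<nu> n) eigenfn)\<^sup>2 = 1 / (2 * n * m z)"
  unfolding norm_R_def has_bochner_integral_integral_eq[OF has_integral_quadratic_form_eigenfn]
  by simp

lemma norm_R_eigenfn_pos: "0 < norm_R (measure_R \<nu> n) eigenfn"
  unfolding norm_R_def has_bochner_integral_integral_eq[OF has_integral_quadratic_form_eigenfn]
  using card_pos atom_pos[OF z] by simp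

section \<open>Boundary conditions and membership in the domain\<close>

lemma OP_0: "\<Phi> 0 = 1"
  by (subst monic_OP.simps) simp

lemma eigenfn_0: "eigenfn 0 = cvec 1"
  by (simp add: eigenfn_def piece_def P_def OP_0 sol_def A_0 B_0 N_0)

text \<open>\<open>\<Phi> n\<close> vanishes at \<open>z\<close>, hence \<open>P n 1 = 0\<close>.
  \<open>P_Suc\<close> expresses this through \<open>P (n - 1) 1\<close>, and the recursions of
  \<open>A\<close> and \<open>B\<close> turn it into \<open>A n * cnj q = B n * q\<close>. Index
  \<open>n\<close> is reached this way because \<open>sol n\<close> would divide by
  \<open>N n = 0\<close>.\<close>

lemma eigenfn_1: "eigenfn 1 \<bullet> (Jmat *v bdry_u1 \<nu> n) = 0"
proof -
  obtain k where k: "n = Suc k" using card_pos by (cases n) auto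
  have "k < n" using k by simp
  define q where "q = sol k (P k 1)"
  have q: "eigenfn 1 = cvec q"
    unfolding q_def piece_def[symmetric] using k by (intro eigenfn_eq) auto
  have "P n 1 = 0" by (simp add: P_def OP_card_root[OF z])
  then have P: "P k 1 - cnj (\<alpha> k) * cnj (P k 1) = 0"
    using P_Suc[OF \<open>k < n\<close>, of 1] k by simp
  have inv: "A k * cnj q - B k * q = P k 1" unfolding q_def by (rule sol_inverse[OF \<open>k < n\<close>])
  have "A n * cnj q - B n * q = (A k * cnj q - B k * q) - cnj (\<alpha> k) * cnj (A k * cnj q - B k * q)"
    unfolding k A_Suc B_Suc by (simp add: algebra_simps)
  also have "\<dots> = 0" unfolding inv by (rule P)
  finally show ?thesis unfolding q by (intro bdry_u1_sol) simp
qed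

lemma is_eigenfunction_eigenfn: "is_eigenfunction (measure_R \<nu> n) bdry_u0 (bdry_u1 \<nu> n) \<mu> eigenfn"
proof -
  have eq: "AE t in lebesgue_on {0..<1}. dirac_op (measure_R \<nu> n) eigenfn t = \<mu> *\<^sub>R eigenfn t"
    using AE_not_grid by eventually_elim (rule dirac_op_eigenfn)
  have L2: "eigenfn \<in> L2_R (measure_R \<nu> n)"
    unfolding L2_R_def using eigenfn_measurable has_integral_quadratic_form_eigenfn
    by (auto simp: has_bochner_integral_iff)
  have meas: "dirac_op (measure_R \<nu> n) eigenfn \<in> borel_measurable (lebesgue_on {0..<1})"
  \<comment> \<open>On the finite grid \<open>vector_derivative\<close> may be arbitrary, so
    measurability is transferred from the multiple of \<open>eigenfn\<close> that agrees with it
    elsewhere.\<close>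
  proof (rule measurable_discrete_difference)
    show "(\<lambda>t. \<mu> *\<^sub>R eigenfn t) \<in> borel_measurable (lebesgue_on {0..<1})"
      using eigenfn_measurable by measurable
    show "countable (grid \<inter> {0..<1})" using finite_grid by (simp add: countable_finite)
    show "{t} \<in> sets (lebesgue_on {0..<1})" if "t \<in> grid \<inter> {0..<1}" for t
      using that by (simp add: sets_restrict_space_iff)
    show "\<mu> *\<^sub>R eigenfn t = dirac_op (measure_R \<nu> n) eigenfn t"
      if "t \<in> space (lebesgue_on {0..<1})" "t \<notin> grid \<inter> {0..<1}" for t
      using that dirac_op_eigenfn[of t] by auto
  qed auto
  have "has_bochner_integral (lebesgue_on {0..<1})
     (\<lambda>s. \<mu>\<^sup>2 * (eigenfn s \<bullet> (measure_R \<nu> n s *v eigenfn s))) (\<mu>\<^sup>2 * (1 / (2 * n * m z)))"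
    by (intro has_bochner_integral_mult_right has_integral_quadratic_form_eigenfn)
  then have "integrable (lebesgue_on {0..<1}) (\<lambda>s. \<mu>\<^sup>2 * (eigenfn s \<bullet> (measure_R \<nu> n s *v eigenfn s)))"
    by (simp add: has_bochner_integral_iff)
  then have "integrable (lebesgue_on {0..<1})
     (\<lambda>s. dirac_op (measure_R \<nu> n) eigenfn s \<bullet> (measure_R \<nu> n s *v dirac_op (measure_R \<nu> n) eigenfn s))"
  proof (rule integrable_discrete_difference[THEN iffD1, rotated -1])
    show "countable (grid \<inter> {0..<1})" using finite_grid by (simp add: countable_finite)
    fix t
    show "{t} \<in> sets (lebesgue_on {0..<1})" "emeasure (lebesgue_on {0..<1}) {t} = 0"
      if "t \<in> grid \<inter> {0..<1}"
      using that by (simp_all add: sets_restrict_space_iff emeasure_restrict_space)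
    show "\<mu>\<^sup>2 * (eigenfn t \<bullet> (measure_R \<nu> n t *v eigenfn t))
        = dirac_op (measure_R \<nu> n) eigenfn t \<bullet> (measure_R \<nu> n t *v dirac_op (measure_R \<nu> n) eigenfn t)"
      if "t \<in> space (lebesgue_on {0..<1})" "t \<notin> grid \<inter> {0..<1}"
      using that dirac_op_eigenfn[of t] by (auto simp: matrix_vector_mult_scaleR power2_eq_square)
  qed
  with meas have L2': "dirac_op (measure_R \<nu> n) eigenfn \<in> L2_R (measure_R \<nu> n)"
    by (simp add: L2_R_def)
  have diff: "AE t in lebesgue_on {0..<1}. eigenfn differentiable at t"
    using AE_not_grid
  proof eventually_elim
    case (elim t)
    then show ?case
      using grid_interval eigenfn_has_vector_derivative differentiableI_vector by blast
  qed
  have AC: "abs_continuous_on 0 1 eigenfn"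
    using lipschitz_on_eigenfn lipschitz_on_imp_abs_continuous_on by blast
  have bd: "eigenfn 0 \<bullet> (Jmat *v bdry_u0) = 0"
    by (simp add: eigenfn_0 bdry_u0_def Jmat_def inner_vec_def sum_2 matrix_vector_mult_def)
  have "\<not> (AE t in lebesgue_on {0..<1}. eigenfn t = 0)"
  proof
    assume "AE t in lebesgue_on {0..<1}. eigenfn t = 0"
    then have "AE t in lebesgue_on {0..<1}. eigenfn t \<bullet> (measure_R \<nu> n t *v eigenfn t) = 0"
      by eventually_elim simp
    then have "norm_R (measure_R \<nu> n) eigenfn = 0"
      unfolding norm_R_def by (simp add: integral_eq_zero_AE)
    then show False using norm_R_eigenfn_pos by simp
  qed
  with eq L2 L2' diff AC bd eigenfn_1 show ?thesis
    by (simp add: is_eigenfunction_def dirac_dom_def)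
qed

text \<open>The boundary condition at 0 leaves one free parameter. Once it is matched, the
  difference \<open>F\<close> vanishes at 0 and solves almost everywhere a linear system with
  bounded coefficients, so the Gronwall lemma applies.\<close>

lemma eigenfunction_unique:
  assumes h: "is_eigenfunction (measure_R \<nu> n) bdry_u0 (bdry_u1 \<nu> n) \<mu> h"
  shows "\<exists>c. \<forall>t\<in>{0..1}. h t = c *\<^sub>R eigenfn t"
proof -
  \<comment> \<open>\<open>eigenfn 0\<close> is the first unit vector, so this is the only
    candidate.\<close>
  define c where "c = h 0 $ 1"
  define F where "F t = h t - c *\<^sub>R eigenfn t" for t
  \<comment> \<open>The equation on piece \<open>k\<close> solved for the derivative; the inverse of
    \<open>Jmat\<close> is its negative.\<close>
  define T where "T k w = - (Jmat *v (Rk k *v (\<mu> *\<^sub>R w)))" for k w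
  define F' where "F' t = T (nat \<lfloor>real n * t\<rfloor>) (F t)" for t
  have bl: "bounded_linear (T k)" for k
    unfolding T_def
    by (intro bounded_linear_minus matrix_vector_mul_bounded_linear[THEN bounded_linear_compose]
        bounded_linear_scaleR_right)
  have "\<forall>k. \<exists>K. \<forall>w. norm (T k w) \<le> norm w * K" using bounded_linear.bounded[OF bl] by blast
  then obtain K where K: "\<And>k w. norm (T k w) \<le> norm w * K k" by metis
  have h_dom: "h \<in> dirac_dom (measure_R \<nu> n) bdry_u0 (bdry_u1 \<nu> n)"
    and "AE t in lebesgue_on {0..<1}. dirac_op (measure_R \<nu> n) h t = \<mu> *\<^sub>R h t"
    using h by (auto simp: is_eigenfunction_def)
  then have "AE t in lebesgue. t \<in> {0..<1} \<longrightarrow>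
      h differentiable (at t) \<and> dirac_op (measure_R \<nu> n) h t = \<mu> *\<^sub>R h t"
    by (auto simp: dirac_dom_def AE_restrict_space_iff)
  then obtain N0 where N0: "negligible N0"
    "\<And>t. t \<in> {0..<1} - N0 \<Longrightarrow> h differentiable (at t) \<and> dirac_op (measure_R \<nu> n) h t = \<mu> *\<^sub>R h t"
    unfolding eventually_ae_filter_negligible by blast
  \<comment> \<open>The sum of absolute values is one constant that serves all pieces.\<close>
  have der: "(F has_vector_derivative F' t) (at t) \<and> norm (F' t) \<le> (\<Sum>k<n. \<bar>K k\<bar>) * norm (F t)"
    if t: "t \<in> {0..1} - (N0 \<union> grid)" for t
  proof -
    obtain k where k: "k < n" "real k / n < t" "t < real (Suc k) / n"
      using grid_interval[of t] t by blast
    have R: "measure_R \<nu> n t = Rk k" and fl: "nat \<lfloor>real n * t\<rfloor> = k"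
      using k by (auto intro: measure_R_eq floor_grid simp del: of_nat_Suc)
    have inv: "invertible (measure_R \<nu> n t)" using R invertible_Rk k by simp
    \<comment> \<open>The facts about \<open>h\<close> hold almost everywhere in
      \<open>{0..<1}\<close>, so the end point 1 has to be ruled out first.\<close>
    have "real (Suc k) / n \<le> 1" using k by simp
    then have "t < 1" using k by linarith
    then have ht: "h differentiable (at t)" "dirac_op (measure_R \<nu> n) h t = \<mu> *\<^sub>R h t"
      using N0(2)[of t] t by auto
    have "vector_derivative h (at t) = T k (h t)"
      using dirac_op_eq_iff[where R = "measure_R \<nu> n" and t = t, OF inv, THEN iffD1, OF ht(2)] unfolding Jmat_mult_eq_iff R T_def .
    then have h': "(h has_vector_derivative T k (h t)) (at t)"
      using ht(1) by (simp add: vector_derivative_works)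
    have "piece' k t = T k (eigenfn t)"
      using Jmat_piece'[OF k(1), of t] k unfolding Jmat_mult_eq_iff T_def by (simp add: eigenfn_eq)
    then have e': "(eigenfn has_vector_derivative T k (eigenfn t)) (at t)"
      using eigenfn_has_vector_derivative[OF k] by simp
    have "(F has_vector_derivative T k (h t) - c *\<^sub>R T k (eigenfn t)) (at t)"
      unfolding F_def[abs_def]
      by (intro has_vector_derivative_diff h'
          bounded_linear.has_vector_derivative[OF bounded_linear_scaleR_right e'])
    also have "T k (h t) - c *\<^sub>R T k (eigenfn t) = F' t"
      using bounded_linear.linear[OF bl[of k]] by (simp add: F'_def F_def fl linear_diff linear_scale)
    finally have 1: "(F has_vector_derivative F' t) (at t)" .
    have "norm (F' t) \<le> norm (F t) * K k" unfolding F'_def fl by (rule K)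
    also have "K k \<le> (\<Sum>k<n. \<bar>K k\<bar>)"
      using member_le_sum[of k "{..<n}" "\<lambda>k. \<bar>K k\<bar>"] k by simp
    then have "norm (F t) * K k \<le> norm (F t) * (\<Sum>k<n. \<bar>K k\<bar>)"
      by (intro mult_left_mono) auto
    finally show ?thesis using 1 by (simp add: mult.commute)
  qed
  have "h 0 $ 2 = 0"
    using h_dom by (simp add: dirac_dom_def bdry_u0_def Jmat_def inner_vec_def sum_2 matrix_vector_mult_def)
  then have F0: "F 0 = 0"
    by (simp add: F_def eigenfn_0 c_def vec_eq_iff forall_2)
  have AC: "abs_continuous_on 0 1 F"
  proof -
    obtain L where "L-lipschitz_on {0..1} eigenfn" using lipschitz_on_eigenfn by blast
    then have "abs_continuous_on 0 1 (\<lambda>t. c *\<^sub>R eigenfn t)"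
      by (rule lipschitz_on_imp_abs_continuous_on[OF lipschitz_on_cmult])
    then show ?thesis
      unfolding F_def[abs_def] using h_dom by (intro abs_continuous_on_diff) (auto simp: dirac_dom_def)
  qed
  have "F t = 0" if "t \<in> {0..1}" for t
    using AC negligible_Un[OF N0(1) negligible_finite[OF finite_grid]] _ _ F0 that
    by (rule abs_continuous_on_gronwall_zero) (use der in auto)
  then show ?thesis by (auto simp: F_def)
qed

lemma left_weight_eigenvalue:
  "left_weight (measure_R \<nu> n) bdry_u0 (bdry_u1 \<nu> n) \<mu> = 2 * n * m z"
  using left_weight_eq[OF is_eigenfunction_eigenfn eigenfunction_unique]
  by (simp add: norm_R_eigenfn eigenfn_0 inner_cvec)

lemma emeasure_mu_left: "emeasure (mu_left \<nu> n) {\<mu>} = ennreal (2 * n * m z)"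
  unfolding mu_left_def
  using dirac_spectrum_eigenvalue[OF is_eigenfunction_eigenfn norm_R_eigenfn_pos]
  by (simp only: emeasure_left_spectral_measure_singleton left_weight_eigenvalue)

end

theorem lemma4:
  fixes \<nu> :: "complex measure" and n :: nat and lam :: "nat \<Rightarrow> real"
    and j :: nat and k :: int
  assumes "prob_space \<nu>" and "sets \<nu> = sets borel"
    and "inj_on (\<lambda>i. exp (\<i> * complex_of_real (lam i))) {1..n}"
    and "AE z in \<nu>. z \<in> (\<lambda>i. exp (\<i> * complex_of_real (lam i))) ` {1..n}"
    and "\<forall>i\<in>{1..n}. 0 < measure \<nu> {exp (\<i> * complex_of_real (lam i))}"
    and "1 \<le> j" and "j \<le> n"
  shows "emeasure (mu_left \<nu> n) {real n * lam j + 2 * real n * real_of_int k * pi} =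
         ennreal (2 * real n * measure \<nu> {exp (\<i> * complex_of_real (lam j))})"
proof -
  define Z where "Z = (\<lambda>i. exp (\<i> * complex_of_real (lam i))) ` {1..n}"
  define z where "z = exp (\<i> * complex_of_real (lam j))"
  define \<mu> where "\<mu> = real n * lam j + 2 * real n * real_of_int k * pi"
  have card: "card Z = n" using assms(3) by (simp add: Z_def card_image)
  have "\<mu> / real n = lam j + 2 * of_int k * pi"
    using assms(6,7) by (simp add: \<mu>_def field_simps)
  \<comment> \<open>The shift by \<open>k\<close> periods, in the shape that
    \<open>exp_plus_2pin\<close> matches.\<close>
  then have "\<i> * of_real (\<mu> / real n) = \<i> * of_real (lam j) + \<i> * (of_int k * (of_real pi * 2))"
    by (simp add: algebra_simps)
  then have exp: "exp (\<i> * of_real (\<mu> / real n)) = z"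
    by (simp only: z_def exp_plus_2pin)
  interpret circle_eigenvalue \<nu> Z z \<mu>
  proof (intro circle_eigenvalue.intro circle_atoms.intro circle_atoms_axioms.intro
      circle_eigenvalue_axioms.intro)
    show "z \<in> Z" using assms(6,7) by (auto simp: Z_def z_def)
  qed (use assms exp card in \<open>auto simp: Z_def\<close>)
  show ?thesis using emeasure_mu_left by (simp add: card \<mu>_def z_def)
qed

end
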